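(* Let $U\colon[0,1]^2\to[0,1]$ be a uninorm. Then $U\in\mathcal{U}$ if and only if $U\in\mathcal{UR}$ and at each point $(x,y)\in[0,1]^2$ the uninorm $U$ is either left-continuous or right-continuous.
   Context: A uninorm is a function $U\colon[0,1]^2\to[0,1]$ which is commutative, associative, non-decreasing (not necessarily strictly) in both variables and has a neutral element $e\in(0,1)$, i.e. $U(e,x)=x$ for all $x\in[0,1]$. For a uninorm $U$ with neutral element $e$, its underlying t-norm and t-conorm are $T_U(x,y)=\frac{1}{e}U(ex,ey)$ and $S_U(x,y)=\frac{U(e+(1-e)x,\,e+(1-e)y)-e}{1-e}$ for $x,y\in[0,1]$. $\mathcal{U}$ denotes the set of all uninorms $U$ such that both $T_U$ and $S_U$ are continuous on $[0,1]^2$. A set-valued function on $[0,1]$ is a mapping $p\colon[0,1]\to\mathcal{P}([0,1])$. It is non-increasing if for all $x_1<x_2$ in $[0,1]$ we have $y_1\ge y_2$ for all $y_1\in p(x_1)$ and all $y_2\in p(x_2)$; symmetric if $y\in p(x)$ if and only if $x\in p(y)$; surjective if for every $y\in[0,1]$ there is an $x\in[0,1]$ with $y\in p(x)$. Its graph is $G(p)=\{(x,y)\in[0,1]^2\mid y\in p(x)\}$. $\mathcal{UR}$ denotes the set of all uninorms $U$ (with neutral element $e$) for which there exists a symmetric, surjective, non-increasing set-valued function $r$ on $[0,1]$ with graph $R=G(r)$ such that $U$, as a function on $[0,1]^2$, is continuous at every point of $[0,1]^2\setminus R$, and $U(x,y)=e$ implies $(x,y)\in R$. $U$ is left-continuous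 at $(x_0,y_0)\in[0,1]^2$ if for every $\varepsilon>0$ there is $\delta>0$ such that $|U(x,y)-U(x_0,y_0)|<\varepsilon$ for all $(x,y)\in[0,1]^2$ with $x\in[x_0-\delta,x_0]$, $y\in[y_0-\delta,y_0]$. Right-continuity at $(x_0,y_0)$ is defined in the same way with $x\in[x_0,x_0+\delta]$, $y\in[y_0,y_0+\delta]$. *)

theory Defs
  imports "HOL-Analysis.Analysis"
begin

text \<open>
  A function from the unit square to the unit interval is modelled by a curried
  function on the reals of which only the values on the unit square matter: every
  notion below looks at arguments in \<open>{0..1}\<close> only.
\<close>

abbreviation unit_square :: "(real \<times> real) set"
  where "unit_square \<equiv> {0..1} \<times> {0..1}"

definition uninorm_with :: "(real \<Rightarrow> real \<Rightarrow> real) \<Rightarrow> real \<Rightarrow> bool"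
  where "uninorm_with U e \<longleftrightarrow>
    (\<forall>x\<in>{0..1}. \<forall>y\<in>{0..1}. U x y \<in> {0..1}) \<and>
    (\<forall>x\<in>{0..1}. \<forall>y\<in>{0..1}. U x y = U y x) \<and>
    (\<forall>x\<in>{0..1}. \<forall>y\<in>{0..1}. \<forall>z\<in>{0..1}. U (U x y) z = U x (U y z)) \<and>
    (\<forall>y\<in>{0..1}. mono_on {0..1} (\<lambda>x. U x y)) \<and>
    (\<forall>x\<in>{0..1}. mono_on {0..1} (\<lambda>y. U x y)) \<and>
    e \<in> {0<..<1} \<and>
    (\<forall>x\<in>{0..1}. U e x = x)"

definition uninorm :: "(real \<Rightarrow> real \<Rightarrow> real) \<Rightarrow> bool"
  where "uninorm U \<longleftrightarrow> (\<exists>e. uninorm_with U e)"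

text \<open>
  The neutral element is unique, so binding it existentially in the definitions of
  the classes of uninorms below leaves no choice.
\<close>

lemma uninorm_neutral_unique:
  assumes "uninorm_with U e" "uninorm_with U e'"
  shows "e = e'"
proof -
  have mem: "e \<in> {0..1}" "e' \<in> {0..1}"
    using assms by (auto simp: uninorm_with_def)
  have "U e e' = e'" "U e' e = e" "U e e' = U e' e"
    using assms mem unfolding uninorm_with_def by blast+
  then show ?thesis by simp
qed

definition underlying_tnorm :: "(real \<Rightarrow> real \<Rightarrow> real) \<Rightarrow> real \<Rightarrow> real \<Rightarrow> real \<Rightarrow> real"
  where "underlying_tnorm U e x y = 1 / e * U (e * x) (e * y)"

definition underlying_tconorm :: "(real \<Rightarrow> real \<Rightarrow> real) \<Rightarrow> real \<Rightarrow> real \<Rightarrow> real \<Rightarrow> real"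
  where "underlying_tconorm U e x y =
    (U (e + (1 - e) * x) (e + (1 - e) * y) - e) / (1 - e)"

definition class_U :: "(real \<Rightarrow> real \<Rightarrow> real) set"
  where "class_U = {U. \<exists>e. uninorm_with U e \<and>
    continuous_on unit_square (\<lambda>(x, y). underlying_tnorm U e x y) \<and>
    continuous_on unit_square (\<lambda>(x, y). underlying_tconorm U e x y)}"

definition set_valued_function :: "(real \<Rightarrow> real set) \<Rightarrow> bool"
  where "set_valued_function p \<longleftrightarrow> (\<forall>x\<in>{0..1}. p x \<subseteq> {0..1})"

definition sv_nonincreasing :: "(real \<Rightarrow> real set) \<Rightarrow> bool"
  where "sv_nonincreasing p \<longleftrightarrow>
    (\<forall>x1\<in>{0..1}. \<forall>x2\<in>{0..1}. x1 < x2 \<longrightarrow> (\<forall>y1\<in>p x1. \<forall>y2\<in>p x2. y1 \<ge> y2))"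

definition sv_symmetric :: "(real \<Rightarrow> real set) \<Rightarrow> bool"
  where "sv_symmetric p \<longleftrightarrow> (\<forall>x\<in>{0..1}. \<forall>y\<in>{0..1}. y \<in> p x \<longleftrightarrow> x \<in> p y)"

definition sv_surjective :: "(real \<Rightarrow> real set) \<Rightarrow> bool"
  where "sv_surjective p \<longleftrightarrow> (\<forall>y\<in>{0..1}. \<exists>x\<in>{0..1}. y \<in> p x)"

definition sv_graph :: "(real \<Rightarrow> real set) \<Rightarrow> (real \<times> real) set"
  where "sv_graph p = {(x, y). (x, y) \<in> unit_square \<and> y \<in> p x}"

definition class_UR :: "(real \<Rightarrow> real \<Rightarrow> real) set"
  where "class_UR = {U. \<exists>e. uninorm_with U e \<and>
    (\<exists>r. set_valued_function r \<and> sv_symmetric r \<and> sv_surjective r \<and> sv_nonincreasing r \<and>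
      (\<forall>z \<in> unit_square - sv_graph r. continuous (at z within unit_square) (\<lambda>(x, y). U x y)) \<and>
      (\<forall>x\<in>{0..1}. \<forall>y\<in>{0..1}. U x y = e \<longrightarrow> (x, y) \<in> sv_graph r))}"

definition left_continuous_at :: "(real \<Rightarrow> real \<Rightarrow> real) \<Rightarrow> real \<Rightarrow> real \<Rightarrow> bool"
  where "left_continuous_at U x0 y0 \<longleftrightarrow>
    (\<forall>\<epsilon>>0. \<exists>\<delta>>0. \<forall>x\<in>{0..1}. \<forall>y\<in>{0..1}.
      x \<in> {x0 - \<delta>..x0} \<longrightarrow> y \<in> {y0 - \<delta>..y0} \<longrightarrow> \<bar>U x y - U x0 y0\<bar> < \<epsilon>)"

definition right_continuous_at :: "(real \<Rightarrow> real \<Rightarrow> real) \<Rightarrow> real \<Rightarrow> real \<Rightarrow> bool"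
  where "right_continuous_at U x0 y0 \<longleftrightarrow>
    (\<forall>\<epsilon>>0. \<exists>\<delta>>0. \<forall>x\<in>{0..1}. \<forall>y\<in>{0..1}.
      x \<in> {x0..x0 + \<delta>} \<longrightarrow> y \<in> {y0..y0 + \<delta>} \<longrightarrow> \<bar>U x y - U x0 y0\<bar> < \<epsilon>)"

end

theory Submission
  imports Defs
begin

text \<open>
  Continuity of the underlying t-norm and t-conorm is the continuity of \<open>U\<close> on the squares
  \<open>[0, e]\<^sup>2\<close> and \<open>[e, 1]\<^sup>2\<close>, so the theorem compares the behaviour of \<open>U\<close> on these two squares with
  its behaviour on the mixed region \<open>[0, e] \<times> [e, 1]\<close>. Reflecting both arguments and the value in
  \<open>1/2\<close> turns a uninorm into a uninorm with the two squares exchanged and left and right exchanged.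
  Hence each fact is proved only below the neutral element.

  Suppose first that \<open>U\<close> is continuous on the two squares. The claim is that \<open>U\<close> is left-continuous
  wherever its value is at most \<open>e\<close>, and also right-continuous wherever its value is still below
  \<open>e\<close> at some point strictly above in both coordinates. Duality then gives right-continuity where
  the value is at least \<open>e\<close>, which settles the one-sided continuity, and continuity off the level
  curve \<open>U = e\<close>, which settles membership in \<open>class_UR\<close>. For the claim, let \<open>x \<le> e \<le> y\<close> and
  \<open>U x y \<le> e\<close>. In the variable \<open>x\<close> divisibility suffices: by continuity below \<open>e\<close>, every
  \<open>v \<le> U x y\<close> is \<open>U (U x y) w = U (U x w) y\<close> for some \<open>w\<close>, so the section \<open>U _ y\<close> maps \<open>[0, x]\<close> onto
  \<open>[0, U x y]\<close> (\<open>section_onto\<close>) and, being monotone, has no jump. In the variable \<open>y\<close> such a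
  division is not available, since factors above \<open>e\<close> can push the value past \<open>e\<close>. There a jump at
  \<open>y\<close> is transported by associativity to a jump at the largest stabilizer of \<open>y\<close>, which is
  idempotent (\<open>maximal_stabilizer\<close>), and jumps at idempotents contradict divisibility
  (\<open>right_limit_at_idempotent\<close>). The remaining points, where the jump on the right goes past \<open>e\<close>, are
  treated by writing \<open>y = U t t\<close> (\<open>section_left_limit_less\<close>).

  Conversely, let \<open>U\<close> be continuous off a nonincreasing symmetric curve that contains the level set
  \<open>U = e\<close>, and one-sidedly continuous everywhere. The curve meets \<open>[0, e]\<^sup>2\<close> only where a coordinate
  is \<open>e\<close>, so by monotonicity only left-continuity at points \<open>(x, e)\<close> has to be shown. If it fails,
  the curve contains \<open>(s, e)\<close> for all \<open>s\<close> just below \<open>x\<close>, hence avoids the region above and to the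
  right of these points. There \<open>U\<close> is continuous, yet passes from the value \<open>s < e\<close> at \<open>(s, e)\<close> to the
  value \<open>1\<close> at \<open>(e, 1)\<close>, so it takes the value \<open>e\<close> off the curve, which is impossible
  (\<open>left_continuous_at_neutral\<close>).
\<close>

section \<open>One-sided limits of real functions\<close>

lemma continuous_on_Icc_less_right:
  fixes f :: "real \<Rightarrow> real"
  assumes "continuous_on {a..b} f" "a \<le> x" "x < b" "f x < c"
  shows "\<exists>x'>x. x' \<le> b \<and> f x' < c"
proof -
  obtain d where d: "d > 0" "\<And>y. y \<in> {a..b} \<Longrightarrow> dist y x < d \<Longrightarrow> dist (f y) (f x) < c - f x"
    using assms unfolding continuous_on_iff
    by (metis atLeastAtMost_iff diff_gt_0_iff_gt less_eq_real_def)
  define x' where "x' = min b (x + d / 2)"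
  have "x < x'" "x' \<le> b" "dist x' x < d"
    using d(1) assms(3) by (auto simp: x'_def dist_real_def)
  moreover from this have "f x' < c"
    using d(2)[of x'] assms(2) by (auto simp: dist_real_def)
  ultimately show ?thesis by blast
qed

lemma continuous_on_Icc_greater_left:
  fixes f :: "real \<Rightarrow> real"
  assumes "continuous_on {a..b} f" "a < x" "x \<le> b" "c < f x"
  shows "\<exists>x'<x. a \<le> x' \<and> c < f x'"
proof -
  obtain d where d: "d > 0" "\<And>y. y \<in> {a..b} \<Longrightarrow> dist y x < d \<Longrightarrow> dist (f y) (f x) < f x - c"
    using assms unfolding continuous_on_iff
    by (metis atLeastAtMost_iff diff_gt_0_iff_gt less_eq_real_def)
  define x' where "x' = max a (x - d / 2)"
  have "x' < x" "a \<le> x'" "dist x' x < d"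
    using d(1) assms(2) by (auto simp: x'_def dist_real_def)
  moreover from this have "c < f x'"
    using d(2)[of x'] assms(3) by (auto simp: dist_real_def)
  ultimately show ?thesis by blast
qed

text \<open>
  For a monotone function the one-sided limits that exclude jumps at the level \<open>c\<close> suffice to attain
  \<open>c\<close>. The assumptions concern only the side on which a jump could skip \<open>c\<close>.
\<close>

lemma mono_intermediate_value:
  fixes f :: "real \<Rightarrow> real"
  assumes ab: "a \<le> b" and c: "f a \<le> c" "c \<le> f b"
    and mono: "mono_on {a..b} f"
    and right: "\<And>y. a \<le> y \<Longrightarrow> y < b \<Longrightarrow> f y < c \<Longrightarrow> \<exists>y'>y. y' \<le> b \<and> f y' < c"
    and left: "\<And>y. a < y \<Longrightarrow> y \<le> b \<Longrightarrow> c < f y \<Longrightarrow> \<exists>y'<y. a \<le> y' \<and> c < f y'"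
  shows "\<exists>y. a \<le> y \<and> y \<le> b \<and> f y = c"
proof -
  define A where "A = {y. a \<le> y \<and> y \<le> b \<and> f y \<le> c}"
  have A: "a \<in> A" "bdd_above A"
    using ab c by (auto simp: A_def intro!: bdd_aboveI[of _ b])
  define s where "s = Sup A"
  have s: "a \<le> s" "s \<le> b"
    unfolding s_def using cSup_upper[OF A] A(1) by (auto simp: A_def intro!: cSup_least)
  have "\<not> f s < c"
  proof
    assume less: "f s < c"
    then have "s \<noteq> b" using c by auto
    then have "s < b" using s by simp
    then obtain y' where "y' > s" "y' \<le> b" "f y' < c" using right s less by blast
    then have "y' \<in> A" using s by (auto simp: A_def)
    then show False using cSup_upper[OF _ A(2)] \<open>y' > s\<close> unfolding s_def by fastforce
  qed
  moreover have "\<not> c < f s"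
  proof
    assume greater: "c < f s"
    then have "s \<noteq> a" using c by auto
    then have "a < s" using s by simp
    then obtain y' where y': "y' < s" "a \<le> y'" "c < f y'" using left s greater by blast
    then obtain y'' where "y'' \<in> A" "y' < y''"
      using less_cSupD[of A y'] A unfolding s_def by blast
    moreover from this have "f y' \<le> f y''"
      using y' by (intro mono_onD[OF mono]) (auto simp: A_def)
    ultimately show False using y' by (auto simp: A_def)
  qed
  ultimately show ?thesis using s by force
qed

section \<open>Uninorms and duality\<close>

locale neutral_uninorm =
  fixes U :: "real \<Rightarrow> real \<Rightarrow> real" and e :: real
  assumes uninorm: "uninorm_with U e"
begin

lemma e_pos: "0 < e" and e_less_1: "e < 1"
  using uninorm by (auto simp: uninorm_with_def)

lemma nonneg: "0 \<le> x \<Longrightarrow> x \<le> 1 \<Longrightarrow> 0 \<le> y \<Longrightarrow> y \<le> 1 \<Longrightarrow> 0 \<le> U x y"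
  and le_1: "0 \<le> x \<Longrightarrow> x \<le> 1 \<Longrightarrow> 0 \<le> y \<Longrightarrow> y \<le> 1 \<Longrightarrow> U x y \<le> 1"
  using uninorm by (auto simp: uninorm_with_def)

lemma comm: "0 \<le> x \<Longrightarrow> x \<le> 1 \<Longrightarrow> 0 \<le> y \<Longrightarrow> y \<le> 1 \<Longrightarrow> U x y = U y x"
  using uninorm by (simp add: uninorm_with_def)

lemma assoc:
  assumes "0 \<le> x" "x \<le> 1" "0 \<le> y" "y \<le> 1" "0 \<le> z" "z \<le> 1"
  shows "U (U x y) z = U x (U y z)"
proof -
  have "\<forall>x\<in>{0..1}. \<forall>y\<in>{0..1}. \<forall>z\<in>{0..1}. U (U x y) z = U x (U y z)"
    using uninorm unfolding uninorm_with_def by blast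
  then show ?thesis using assms by simp
qed

lemma mono:
  assumes "0 \<le> x" "x \<le> x'" "x' \<le> 1" "0 \<le> y" "y \<le> y'" "y' \<le> 1"
  shows "U x y \<le> U x' y'"
proof -
  have "mono_on {0..1} (\<lambda>x. U x y)" "mono_on {0..1} (U x')"
    using uninorm assms unfolding uninorm_with_def by auto
  then have "U x y \<le> U x' y" "U x' y \<le> U x' y'"
    using assms by (auto simp: mono_on_def)
  then show ?thesis by simp
qed

lemma neutral_left: "0 \<le> x \<Longrightarrow> x \<le> 1 \<Longrightarrow> U e x = x"
  using uninorm by (auto simp: uninorm_with_def)

lemma neutral_right: "0 \<le> x \<Longrightarrow> x \<le> 1 \<Longrightarrow> U x e = x"
  using neutral_left[of x] comm[of x e] e_pos e_less_1 by simp

lemma le_left: "0 \<le> x \<Longrightarrow> x \<le> 1 \<Longrightarrow> 0 \<le> y \<Longrightarrow> y \<le> e \<Longrightarrow> U x y \<le> x"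
  using mono[of x x y e] neutral_right[of x] e_less_1 by simp

lemma ge_left: "0 \<le> x \<Longrightarrow> x \<le> 1 \<Longrightarrow> e \<le> y \<Longrightarrow> y \<le> 1 \<Longrightarrow> x \<le> U x y"
  using mono[of x x e y] neutral_right[of x] e_pos by simp

lemma ge_right: "0 \<le> x \<Longrightarrow> x \<le> 1 \<Longrightarrow> e \<le> y \<Longrightarrow> y \<le> 1 \<Longrightarrow> x \<le> U y x"
  using ge_left[of x y] comm[of x y] e_pos by simp

lemma zero_left: "0 \<le> y \<Longrightarrow> y \<le> e \<Longrightarrow> U 0 y = 0"
  using le_left[of 0 y] nonneg[of 0 y] e_less_1 by simp

lemma swap: "0 \<le> x \<Longrightarrow> x \<le> 1 \<Longrightarrow> 0 \<le> y \<Longrightarrow> y \<le> 1 \<Longrightarrow> 0 \<le> z \<Longrightarrow> z \<le> 1 \<Longrightarrow> U (U x y) z = U (U x z) y"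
  using assoc[of x y z] assoc[of x z y] comm[of y z] by simp

text \<open>
  Elements that are invertible have one inverse only, so the level set \<open>U = e\<close> contains no
  horizontal segment and no open rectangle.
\<close>

lemma inverse_unique:
  assumes "0 \<le> x" "x \<le> 1" "0 \<le> x'" "x' \<le> 1" "0 \<le> y" "y \<le> 1" "U x y = e" "U x' y = e"
  shows "x = x'"
  using swap[of x y x'] swap[of x' y x] comm[of x x'] neutral_left assms by simp

text \<open>
  For a monotone function of two variables a single point below and to the left with a value close to
  \<open>U x y\<close> controls a whole left neighbourhood. A coordinate \<open>0\<close> has no smaller points, so there
  the coordinate itself serves as the witness.
\<close>

lemma left_continuous_atI:
  assumes xy: "0 \<le> x" "x \<le> 1" "0 \<le> y" "y \<le> 1"
    and approx: "\<And>p. p < U x y \<Longrightarrow>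
      \<exists>x' y'. 0 \<le> x' \<and> (x' < x \<or> x' = x \<and> x = 0) \<and> 0 \<le> y' \<and> (y' < y \<or> y' = y \<and> y = 0) \<and> p < U x' y'"
  shows "left_continuous_at U x y"
  unfolding left_continuous_at_def
proof (intro allI impI)
  fix \<epsilon> :: real assume "\<epsilon> > 0"
  then obtain x' y' where p: "0 \<le> x'" "x' < x \<or> x' = x \<and> x = 0" "0 \<le> y'" "y' < y \<or> y' = y \<and> y = 0"
    "U x y - \<epsilon> < U x' y'"
    using approx[of "U x y - \<epsilon>"] by auto
  define \<delta> where "\<delta> = min (if x' < x then x - x' else 1) (if y' < y then y - y' else 1)"
  have "\<delta> > 0" by (auto simp: \<delta>_def)
  moreover have "\<bar>U a b - U x y\<bar> < \<epsilon>"
    if "a \<in> {0..1}" "b \<in> {0..1}" "a \<in> {x - \<delta>..x}" "b \<in> {y - \<delta>..y}" for a b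
  proof -
    have "x' \<le> a" "y' \<le> b"
      using that p by (auto simp: \<delta>_def split: if_splits)
    then have "U x' y' \<le> U a b" "U a b \<le> U x y"
      using mono p that xy by auto
    then show ?thesis using p by simp
  qed
  ultimately show "\<exists>\<delta>>0. \<forall>a\<in>{0..1}. \<forall>b\<in>{0..1}.
      a \<in> {x - \<delta>..x} \<longrightarrow> b \<in> {y - \<delta>..y} \<longrightarrow> \<bar>U a b - U x y\<bar> < \<epsilon>" by blast
qed

lemma right_continuous_atI:
  assumes xy: "0 \<le> x" "x < 1" "0 \<le> y" "y < 1"
    and approx: "\<And>p. U x y < p \<Longrightarrow> \<exists>x' y'. x < x' \<and> x' \<le> 1 \<and> y < y' \<and> y' \<le> 1 \<and> U x' y' < p"
  shows "right_continuous_at U x y"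
  unfolding right_continuous_at_def
proof (intro allI impI)
  fix \<epsilon> :: real assume "\<epsilon> > 0"
  then obtain x' y' where p: "x < x'" "x' \<le> 1" "y < y'" "y' \<le> 1" "U x' y' < U x y + \<epsilon>"
    using approx[of "U x y + \<epsilon>"] by auto
  define \<delta> where "\<delta> = min (x' - x) (y' - y)"
  have "\<delta> > 0" using p by (auto simp: \<delta>_def)
  moreover have "\<bar>U a b - U x y\<bar> < \<epsilon>"
    if "a \<in> {0..1}" "b \<in> {0..1}" "a \<in> {x..x + \<delta>}" "b \<in> {y..y + \<delta>}" for a b
  proof -
    have "a \<le> x'" "b \<le> y'"
      using that by (auto simp: \<delta>_def)
    then have "U a b \<le> U x' y'" "U x y \<le> U a b"
      using mono p that xy by auto
    then show ?thesis using p by simp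
  qed
  ultimately show "\<exists>\<delta>>0. \<forall>a\<in>{0..1}. \<forall>b\<in>{0..1}.
      a \<in> {x..x + \<delta>} \<longrightarrow> b \<in> {y..y + \<delta>} \<longrightarrow> \<bar>U a b - U x y\<bar> < \<epsilon>" by blast
qed

text \<open>
  Left and right neighbourhoods do not cover a neighbourhood of a point in the square; monotonicity
  bounds the values in the two remaining quadrants by those at the componentwise minimum and maximum
  with the point.
\<close>

lemma continuous_iff_left_right:
  assumes xy: "0 \<le> x" "x \<le> 1" "0 \<le> y" "y \<le> 1"
  shows "continuous (at (x, y) within unit_square) (\<lambda>(x, y). U x y) \<longleftrightarrow>
    left_continuous_at U x y \<and> right_continuous_at U x y"
proof
  assume cont: "continuous (at (x, y) within unit_square) (\<lambda>(x, y). U x y)"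
  have near: "\<exists>\<delta>>0. \<forall>a\<in>{0..1}. \<forall>b\<in>{0..1}. \<bar>a - x\<bar> \<le> \<delta> \<longrightarrow> \<bar>b - y\<bar> \<le> \<delta> \<longrightarrow> \<bar>U a b - U x y\<bar> < \<epsilon>"
    if \<epsilon>: "\<epsilon> > 0" for \<epsilon>
  proof -
    obtain d where d: "d > 0" "\<And>z. z \<in> unit_square \<Longrightarrow> dist z (x, y) < d \<Longrightarrow>
        dist (case z of (x, y) \<Rightarrow> U x y) (U x y) < \<epsilon>"
      using cont \<epsilon> unfolding continuous_within_eps_delta prod.case by meson
    have "\<bar>U a b - U x y\<bar> < \<epsilon>"
      if "a \<in> {0..1}" "b \<in> {0..1}" "\<bar>a - x\<bar> \<le> d / 3" "\<bar>b - y\<bar> \<le> d / 3" for a b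
    proof -
      have "dist (a, b) (x, y) \<le> \<bar>a - x\<bar> + \<bar>b - y\<bar>"
        unfolding dist_Pair_Pair dist_real_def using sqrt_sum_squares_le_sum_abs[of "a - x" "b - y"] by simp
      also have "\<dots> < d" using that d(1) by linarith
      finally show ?thesis using d(2)[of "(a, b)"] that by (simp add: dist_real_def)
    qed
    then show ?thesis using d(1) by (intro exI[of _ "d / 3"]) auto
  qed
  show "left_continuous_at U x y \<and> right_continuous_at U x y"
    unfolding left_continuous_at_def right_continuous_at_def
  proof (intro conjI allI impI)
    fix \<epsilon> :: real assume "\<epsilon> > 0"
    then obtain \<delta> where \<delta>: "\<delta> > 0"
      "\<forall>a\<in>{0..1}. \<forall>b\<in>{0..1}. \<bar>a - x\<bar> \<le> \<delta> \<longrightarrow> \<bar>b - y\<bar> \<le> \<delta> \<longrightarrow> \<bar>U a b - U x y\<bar> < \<epsilon>"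
      using near by blast
    show "\<exists>\<delta>>0. \<forall>a\<in>{0..1}. \<forall>b\<in>{0..1}.
      a \<in> {x - \<delta>..x} \<longrightarrow> b \<in> {y - \<delta>..y} \<longrightarrow> \<bar>U a b - U x y\<bar> < \<epsilon>"
      using \<delta> by (intro exI[of _ \<delta>]) auto
    show "\<exists>\<delta>>0. \<forall>a\<in>{0..1}. \<forall>b\<in>{0..1}.
      a \<in> {x..x + \<delta>} \<longrightarrow> b \<in> {y..y + \<delta>} \<longrightarrow> \<bar>U a b - U x y\<bar> < \<epsilon>"
      using \<delta> by (intro exI[of _ \<delta>]) auto
  qed
next
  assume lr: "left_continuous_at U x y \<and> right_continuous_at U x y"
  show "continuous (at (x, y) within unit_square) (\<lambda>(x, y). U x y)"
    unfolding continuous_within_eps_delta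
  proof (intro allI impI)
    fix \<epsilon> :: real assume "\<epsilon> > 0"
    then obtain d1 where d1: "d1 > 0" "\<And>a b. a \<in> {0..1} \<Longrightarrow> b \<in> {0..1} \<Longrightarrow>
        a \<in> {x - d1..x} \<Longrightarrow> b \<in> {y - d1..y} \<Longrightarrow> \<bar>U a b - U x y\<bar> < \<epsilon>"
      using lr unfolding left_continuous_at_def by meson
    from \<open>\<epsilon> > 0\<close> obtain d2 where d2: "d2 > 0" "\<And>a b. a \<in> {0..1} \<Longrightarrow> b \<in> {0..1} \<Longrightarrow>
        a \<in> {x..x + d2} \<Longrightarrow> b \<in> {y..y + d2} \<Longrightarrow> \<bar>U a b - U x y\<bar> < \<epsilon>"
      using lr unfolding right_continuous_at_def by meson
    have "\<bar>U a b - U x y\<bar> < \<epsilon>"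
      if ab: "a \<in> {0..1}" "b \<in> {0..1}" and d: "dist (a, b) (x, y) < min d1 d2" for a b
    proof -
      have "\<bar>a - x\<bar> < min d1 d2" "\<bar>b - y\<bar> < min d1 d2"
        using d dist_fst_le[of "(a, b)" "(x, y)"] dist_snd_le[of "(a, b)" "(x, y)"]
        by (auto simp: dist_real_def)
      then have "\<bar>U (min a x) (min b y) - U x y\<bar> < \<epsilon>" "\<bar>U (max a x) (max b y) - U x y\<bar> < \<epsilon>"
        using ab xy d1(1) d2(1) by (intro d1 d2; auto)+
      moreover have "U (min a x) (min b y) \<le> U a b" "U a b \<le> U (max a x) (max b y)"
        using ab xy by (intro mono; auto)+
      ultimately show ?thesis by linarith
    qed
    then show "\<exists>d>0. \<forall>z\<in>unit_square. dist z (x, y) < d \<longrightarrow>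
        dist (case z of (x, y) \<Rightarrow> U x y) (case (x, y) of (x, y) \<Rightarrow> U x y) < \<epsilon>"
      using d1(1) d2(1) by (intro exI[of _ "min d1 d2"]) (auto simp: dist_real_def)
  qed
qed

lemma left_continuous_at_comm:
  assumes xy: "0 \<le> x" "x \<le> 1" "0 \<le> y" "y \<le> 1" and cont: "left_continuous_at U x y"
  shows "left_continuous_at U y x"
  unfolding left_continuous_at_def
proof (intro allI impI)
  fix \<epsilon> :: real assume "\<epsilon> > 0"
  then obtain \<delta> where \<delta>: "\<delta> > 0" "\<And>a b. a \<in> {0..1} \<Longrightarrow> b \<in> {0..1} \<Longrightarrow>
      a \<in> {x - \<delta>..x} \<Longrightarrow> b \<in> {y - \<delta>..y} \<Longrightarrow> \<bar>U a b - U x y\<bar> < \<epsilon>"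
    using cont unfolding left_continuous_at_def by meson
  have "\<bar>U b a - U y x\<bar> < \<epsilon>"
    if "a \<in> {0..1}" "b \<in> {0..1}" "a \<in> {x - \<delta>..x}" "b \<in> {y - \<delta>..y}" for a b
    using \<delta>(2)[OF that] that comm[of a b] comm[of x y] xy by simp
  then show "\<exists>\<delta>>0. \<forall>b\<in>{0..1}. \<forall>a\<in>{0..1}.
      b \<in> {y - \<delta>..y} \<longrightarrow> a \<in> {x - \<delta>..x} \<longrightarrow> \<bar>U b a - U y x\<bar> < \<epsilon>"
    using \<delta>(1) by blast
qed

lemma right_continuous_at_comm:
  assumes xy: "0 \<le> x" "x \<le> 1" "0 \<le> y" "y \<le> 1" and cont: "right_continuous_at U x y"
  shows "right_continuous_at U y x"
  unfolding right_continuous_at_def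
proof (intro allI impI)
  fix \<epsilon> :: real assume "\<epsilon> > 0"
  then obtain \<delta> where \<delta>: "\<delta> > 0" "\<And>a b. a \<in> {0..1} \<Longrightarrow> b \<in> {0..1} \<Longrightarrow>
      a \<in> {x..x + \<delta>} \<Longrightarrow> b \<in> {y..y + \<delta>} \<Longrightarrow> \<bar>U a b - U x y\<bar> < \<epsilon>"
    using cont unfolding right_continuous_at_def by meson
  have "\<bar>U b a - U y x\<bar> < \<epsilon>"
    if "a \<in> {0..1}" "b \<in> {0..1}" "a \<in> {x..x + \<delta>}" "b \<in> {y..y + \<delta>}" for a b
    using \<delta>(2)[OF that] that comm[of a b] comm[of x y] xy by simp
  then show "\<exists>\<delta>>0. \<forall>b\<in>{0..1}. \<forall>a\<in>{0..1}.
      b \<in> {y..y + \<delta>} \<longrightarrow> a \<in> {x..x + \<delta>} \<longrightarrow> \<bar>U b a - U y x\<bar> < \<epsilon>"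
    using \<delta>(1) by blast
qed

end

definition dual_uninorm :: "(real \<Rightarrow> real \<Rightarrow> real) \<Rightarrow> real \<Rightarrow> real \<Rightarrow> real"
  where "dual_uninorm U x y = 1 - U (1 - x) (1 - y)"

lemma dual_dual_uninorm: "dual_uninorm (dual_uninorm U) = U"
  by (simp add: dual_uninorm_def fun_eq_iff)

lemma left_continuous_at_dual_uninorm:
  "left_continuous_at (dual_uninorm U) x y \<longleftrightarrow> right_continuous_at U (1 - x) (1 - y)" (is "?L \<longleftrightarrow> ?R")
proof
  assume ?L
  show ?R
    unfolding right_continuous_at_def
  proof (intro allI impI)
    fix \<epsilon> :: real assume "\<epsilon> > 0"
    then obtain \<delta> where \<delta>: "\<delta> > 0" "\<And>a b. a \<in> {0..1} \<Longrightarrow> b \<in> {0..1} \<Longrightarrow>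
      a \<in> {x - \<delta>..x} \<Longrightarrow> b \<in> {y - \<delta>..y} \<Longrightarrow> \<bar>dual_uninorm U a b - dual_uninorm U x y\<bar> < \<epsilon>"
      using \<open>?L\<close> unfolding left_continuous_at_def by metis
    have "\<bar>U a b - U (1 - x) (1 - y)\<bar> < \<epsilon>" if "a \<in> {0..1}" "b \<in> {0..1}"
      "a \<in> {1 - x..1 - x + \<delta>}" "b \<in> {1 - y..1 - y + \<delta>}" for a b
      using \<delta>(2)[of "1 - a" "1 - b"] that by (auto simp: dual_uninorm_def)
    then show "\<exists>\<delta>>0. \<forall>a\<in>{0..1}. \<forall>b\<in>{0..1}. a \<in> {1 - x..1 - x + \<delta>} \<longrightarrow>
        b \<in> {1 - y..1 - y + \<delta>} \<longrightarrow> \<bar>U a b - U (1 - x) (1 - y)\<bar> < \<epsilon>"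
      using \<delta>(1) by blast
  qed
next
  assume ?R
  show ?L
    unfolding left_continuous_at_def
  proof (intro allI impI)
    fix \<epsilon> :: real assume "\<epsilon> > 0"
    then obtain \<delta> where \<delta>: "\<delta> > 0" "\<And>a b. a \<in> {0..1} \<Longrightarrow> b \<in> {0..1} \<Longrightarrow>
      a \<in> {1 - x..1 - x + \<delta>} \<Longrightarrow> b \<in> {1 - y..1 - y + \<delta>} \<Longrightarrow> \<bar>U a b - U (1 - x) (1 - y)\<bar> < \<epsilon>"
      using \<open>?R\<close> unfolding right_continuous_at_def by metis
    have "\<bar>dual_uninorm U a b - dual_uninorm U x y\<bar> < \<epsilon>" if "a \<in> {0..1}" "b \<in> {0..1}"
      "a \<in> {x - \<delta>..x}" "b \<in> {y - \<delta>..y}" for a b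
      using \<delta>(2)[of "1 - a" "1 - b"] that by (auto simp: dual_uninorm_def)
    then show "\<exists>\<delta>>0. \<forall>a\<in>{0..1}. \<forall>b\<in>{0..1}. a \<in> {x - \<delta>..x} \<longrightarrow>
        b \<in> {y - \<delta>..y} \<longrightarrow> \<bar>dual_uninorm U a b - dual_uninorm U x y\<bar> < \<epsilon>"
      using \<delta>(1) by blast
  qed
qed

lemma right_continuous_at_dual_uninorm:
  "right_continuous_at (dual_uninorm U) x y \<longleftrightarrow> left_continuous_at U (1 - x) (1 - y)"
  using left_continuous_at_dual_uninorm[of "dual_uninorm U" "1 - x" "1 - y"]
  by (simp add: dual_dual_uninorm)

lemma (in neutral_uninorm) neutral_uninorm_dual: "neutral_uninorm (dual_uninorm U) (1 - e)"
proof
  have "dual_uninorm U x y = dual_uninorm U y x" if "x \<in> {0..1}" "y \<in> {0..1}" for x y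
    using that comm[of "1 - x" "1 - y"] by (simp add: dual_uninorm_def)
  moreover have "dual_uninorm U (dual_uninorm U x y) z = dual_uninorm U x (dual_uninorm U y z)"
    if "x \<in> {0..1}" "y \<in> {0..1}" "z \<in> {0..1}" for x y z
    using that assoc[of "1 - x" "1 - y" "1 - z"] by (simp add: dual_uninorm_def)
  moreover have "dual_uninorm U (1 - e) x = x" if "x \<in> {0..1}" for x
    using that neutral_left[of "1 - x"] by (simp add: dual_uninorm_def)
  moreover have "mono_on {0..1} (\<lambda>x. dual_uninorm U x y)" "mono_on {0..1} (\<lambda>x. dual_uninorm U y x)"
    if "y \<in> {0..1}" for y
    using that by (auto intro!: mono_onI mono simp: dual_uninorm_def)
  moreover have "dual_uninorm U x y \<in> {0..1}" if "x \<in> {0..1}" "y \<in> {0..1}" for x y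
    using that nonneg[of "1 - x" "1 - y"] le_1[of "1 - x" "1 - y"] by (simp add: dual_uninorm_def)
  ultimately show "uninorm_with (dual_uninorm U) (1 - e)"
    using e_pos e_less_1 unfolding uninorm_with_def by simp
qed

lemma continuous_on_dual_uninorm:
  assumes "continuous_on ({a..b} \<times> {a..b}) (\<lambda>(x, y). U x y)"
  shows "continuous_on ({1 - b..1 - a} \<times> {1 - b..1 - a}) (\<lambda>(x, y). dual_uninorm U x y)"
proof -
  have "continuous_on ({1 - b..1 - a} \<times> {1 - b..1 - a})
    (\<lambda>z. 1 - (\<lambda>(x, y). U x y) (1 - fst z, 1 - snd z))"
    by (intro continuous_intros continuous_on_compose2[OF assms]) auto
  then show ?thesis by (simp add: dual_uninorm_def case_prod_beta)
qed

section \<open>Sections of a uninorm with continuous underlying operations\<close>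

locale underlying_continuous_uninorm = neutral_uninorm +
  assumes lower: "continuous_on ({0..e} \<times> {0..e}) (\<lambda>(x, y). U x y)"
    and upper: "continuous_on ({e..1} \<times> {e..1}) (\<lambda>(x, y). U x y)"
begin

lemma lower_section: "0 \<le> w \<Longrightarrow> w \<le> e \<Longrightarrow> continuous_on {0..e} (U w)"
  using continuous_on_compose2[OF lower, of "{0..e}" "\<lambda>y. (w, y)"]
  by (simp add: continuous_on_Pair image_subset_iff)

lemma upper_section: "e \<le> w \<Longrightarrow> w \<le> 1 \<Longrightarrow> continuous_on {e..1} (U w)"
  using continuous_on_compose2[OF upper, of "{e..1}" "\<lambda>y. (w, y)"]
  by (simp add: continuous_on_Pair image_subset_iff)

lemma upper_diagonal: "continuous_on {e..1} (\<lambda>t. U t t)"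
  using continuous_on_compose2[OF upper, of "{e..1}" "\<lambda>t. (t, t)"]
  by (simp add: continuous_on_Pair image_subset_iff)

text \<open>
  The intermediate value theorem for the section \<open>U u\<close>, which runs from \<open>0\<close> at \<open>0\<close> to \<open>u\<close> at \<open>e\<close>.
\<close>

lemma lower_divisible:
  assumes "0 \<le> v" "v \<le> u" "u \<le> e"
  shows "\<exists>w. 0 \<le> w \<and> w \<le> e \<and> U u w = v"
  using assms e_pos e_less_1 zero_left[of u] comm[of u 0] neutral_right[of u]
  by (intro IVT') (auto intro: lower_section)

text \<open>
  Divide the value \<open>U x y\<close>, which lies in \<open>[0, e]\<close>, and move the factor over to \<open>x\<close>. Consequently the
  monotone section \<open>U _ y\<close> has no jump on \<open>[0, x]\<close>.
\<close>

lemma section_onto: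
  assumes x: "0 \<le> x" "x \<le> e" and y: "e \<le> y" "y \<le> 1" and "U x y \<le> e" and v: "0 \<le> v" "v \<le> U x y"
  shows "\<exists>x'. 0 \<le> x' \<and> x' \<le> x \<and> U x' y = v"
proof -
  obtain w where w: "0 \<le> w" "w \<le> e" "U (U x y) w = v"
    using lower_divisible[of v "U x y"] assms by auto
  have "U (U x w) y = v"
    using w swap[of x y w] x y e_less_1 e_pos by simp
  moreover have "0 \<le> U x w" "U x w \<le> x"
    using w x e_less_1 nonneg le_left by auto
  ultimately show ?thesis by blast
qed

text \<open>
  Suppose that \<open>U q z\<close> stays above some \<open>p > q\<close> for \<open>z > z0\<close>, and let \<open>l > q\<close> be its infimum. Since
  \<open>z0\<close> is idempotent, two factors close to \<open>z0\<close> have a product close to \<open>z0\<close>; hence multiplying by one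
  more such factor moves \<open>l\<close> only a little. Divide \<open>q\<close> by some \<open>s\<close> strictly between \<open>q\<close> and \<open>l\<close>: the
  quotient \<open>w\<close> fixes \<open>l\<close>, and therefore also \<open>s\<close>, which is a multiple \<open>U l z\<close> of \<open>l\<close>. This contradicts
  \<open>U s w = q\<close>.
\<close>

lemma right_limit_at_idempotent:
  assumes z0: "e \<le> z0" "U z0 z0 = z0" and z1: "z0 < z1" "z1 \<le> 1" "U q z1 < e"
    and q: "0 \<le> q" "q < e" and p: "q < p"
  shows "\<exists>z>z0. z \<le> 1 \<and> U q z < p"
proof (rule ccontr)
  assume "\<not> ?thesis"
  then have ge: "p \<le> U q z" if "z0 < z" "z \<le> 1" for z
    using that by force
  define A where "A = (\<lambda>z. U q z) ` {z0<..1}"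
  define l where "l = Inf A"
  have A: "U q z1 \<in> A" "bdd_below A"
    using z1 ge by (auto simp: A_def intro!: bdd_belowI[of _ p])
  have lower_bound: "l \<le> U q z" if "z0 < z" "z \<le> 1" for z
    unfolding l_def using that A by (auto intro!: cInf_lower simp: A_def)
  have "p \<le> l"
    unfolding l_def using A ge by (auto intro!: cInf_greatest simp: A_def)
  have "l < e"
    using lower_bound[of z1] z1 by simp
  \<comment> \<open>\<open>U l y \<le> U (U q y) y = U q (U y y)\<close>, and \<open>U y y\<close> is close to \<open>z0\<close> when \<open>y\<close> is.\<close>
  have l_stable: "\<exists>z>z0. z \<le> 1 \<and> U l z < c" if "l < c" for c
  proof -
    have "A \<noteq> {}" using A(1) by blast
    from cInf_lessD[OF this that[unfolded l_def]] obtain v where "v \<in> A" "v < c" ..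
    then obtain z where z: "z0 < z" "z \<le> 1" "U q z < c"
      unfolding A_def by auto
    obtain y where y: "z0 < y" "y \<le> 1" "U y y < z"
      using continuous_on_Icc_less_right[OF upper_diagonal, of z0 z] z z0 by auto
    have "U l y \<le> U (U q y) y"
      using lower_bound[of y] y z0 q e_pos e_less_1 p \<open>p \<le> l\<close> by (intro mono le_1) auto
    also have "\<dots> = U q (U y y)"
      using y z0 q e_pos e_less_1 by (intro assoc) auto
    also have "\<dots> \<le> U q z"
      using y z z0 q e_pos e_less_1 by (intro mono nonneg) auto
    finally show ?thesis using z y by auto
  qed
  define s where "s = (q + l) / 2"
  have s: "q < s" "s < l" using p \<open>p \<le> l\<close> by (auto simp: s_def)
  obtain w where w: "0 \<le> w" "w \<le> e" "U s w = q"
    using lower_divisible[of q s] s \<open>l < e\<close> q by auto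
  \<comment> \<open>Otherwise \<open>U w l' < l\<close> for some \<open>l' > l\<close>, while \<open>U q z = U w (U s z) \<le> U w (U l z) \<le> U w l'\<close> for
    some \<open>z > z0\<close>.\<close>
  have "l \<le> U w l"
  proof (rule ccontr)
    assume "\<not> l \<le> U w l"
    then obtain l' where l': "l < l'" "l' \<le> e" "U w l' < l"
      using continuous_on_Icc_less_right[OF lower_section, of w l l] w s q \<open>l < e\<close> by auto
    obtain z where z: "z0 < z" "z \<le> 1" "U l z < l'"
      using l_stable[OF \<open>l < l'\<close>] by auto
    have "U q z = U w (U s z)"
      using w z z0 s q \<open>l < e\<close> e_less_1 assoc[of w s z] comm[of w s] by simp
    also have "\<dots> \<le> U w l'"
      using mono[of s l z z] w z z0 s q \<open>l < e\<close> l' e_less_1 by (intro mono nonneg) auto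
    finally show False using lower_bound[of z] z l' by simp
  qed
  then have "U w l = l"
    using le_left[of l w] comm[of l w] w s q \<open>l < e\<close> e_less_1 by simp
  obtain z where z: "0 \<le> z" "z \<le> e" "U l z = s"
    using lower_divisible[of s l] s q \<open>l < e\<close> by auto
  have "U s w = U (U l w) z"
    using swap[of l z w] z w s q \<open>l < e\<close> e_less_1 by simp
  also have "\<dots> = s"
    using \<open>U w l = l\<close> comm[of l w] z w s q \<open>l < e\<close> e_less_1 by simp
  finally show False using w s by simp
qed

text \<open>
  The stabilizer of \<open>y\<close> is closed under products and topologically closed, so its largest element is
  idempotent.
\<close>

lemma maximal_stabilizer:
  assumes y: "e \<le> y" "y < 1"
  obtains z where "e \<le> z" "z < 1" "U y z = y" "U z z = z" "\<And>z'. z < z' \<Longrightarrow> z' \<le> 1 \<Longrightarrow> y < U y z'"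
proof -
  define A where "A = {z \<in> {e..1}. U y z = y}"
  have "closed A"
    unfolding A_def
    using continuous_closed_preimage_constant[OF upper_section closed_atLeastAtMost, of y y] y by simp
  moreover have A: "e \<in> A" "bdd_above A"
    using neutral_right[of y] e_pos e_less_1 y by (auto simp: A_def intro!: bdd_aboveI[of _ 1])
  ultimately have "Sup A \<in> A"
    by (intro closed_contains_Sup) auto
  define z where "z = Sup A"
  have z: "e \<le> z" "z \<le> 1" "U y z = y"
    using \<open>Sup A \<in> A\<close> by (auto simp: A_def z_def)
  have max: "y < U y z'" if "z < z'" "z' \<le> 1" for z'
  proof -
    have "z' \<notin> A" using cSup_upper[OF _ A(2), of z'] that by (auto simp: z_def)
    moreover have "y \<le> U y z'" using ge_left that z y e_pos by simp
    ultimately show ?thesis using that z by (auto simp: A_def)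
  qed
  have "U y 1 = 1"
    using ge_right[of 1 y] le_1[of y 1] y e_pos e_less_1 by simp
  then have "z < 1"
    using z y by (cases "z = 1") auto
  have "U y (U z z) = y"
    using assoc[of y z z] z y e_pos by simp
  then have "\<not> z < U z z"
    using max[of "U z z"] le_1[of z z] z e_pos by auto
  then have "U z z = z"
    using ge_left[of z z] z e_pos by simp
  then show ?thesis using that z max \<open>z < 1\<close> by blast
qed

text \<open>
  With \<open>z0\<close> the largest stabilizer of \<open>y\<close> and \<open>q = U x y\<close>, the products \<open>U y z\<close> with \<open>z > z0\<close> lie
  above \<open>y\<close>, and \<open>U x (U y z) = U q z\<close>. Hence \<open>U x\<close> can only jump to the right of \<open>y\<close> if \<open>U q\<close> jumps to
  the right of the idempotent \<open>z0\<close>.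
\<close>

lemma section_right_limit:
  assumes x: "0 \<le> x" "x \<le> e" and y: "e \<le> y" "y < y1" "y1 \<le> 1" "U x y1 < e" and p: "U x y < p"
  shows "\<exists>y'>y. y' \<le> 1 \<and> U x y' < p"
proof -
  obtain z0 where z0: "e \<le> z0" "z0 < 1" "U y z0 = y" "U z0 z0 = z0"
      "\<And>z. z0 < z \<Longrightarrow> z \<le> 1 \<Longrightarrow> y < U y z"
    using maximal_stabilizer[of y] y by auto
  define q where "q = U x y"
  have q: "0 \<le> q" "q < e"
    using mono[of x x y y1] nonneg[of x y] x y e_pos e_less_1 by (auto simp: q_def)
  have shift: "U q z = U x (U y z)" if "e \<le> z" "z \<le> 1" for z
    unfolding q_def using that x y e_pos e_less_1 by (intro assoc) auto
  obtain z1 where z1: "z0 < z1" "z1 \<le> 1" "U y z1 < y1"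
    using continuous_on_Icc_less_right[OF upper_section, of y z0 y1] z0 y by auto
  have "U q z1 < e"
    using shift[of z1] mono[of x x "U y z1" y1] nonneg[of y z1] x y z0 z1 e_pos e_less_1 by simp
  then obtain z where z: "z0 < z" "z \<le> 1" "U q z < p"
    using right_limit_at_idempotent[of z0 z1 q p] z0 z1 q p by (auto simp: q_def)
  have "U x (U y z) < p" using shift[of z] z z0 by simp
  then show ?thesis
    using z0(5)[of z] z le_1[of y z] z0(1) y e_pos by auto
qed

text \<open>
  A jump from at most \<open>p\<close> to \<open>q = U x y\<close> on the left of \<open>y\<close> would produce a jump on the right of the
  largest stabilizer \<open>z0\<close>: as \<open>z0\<close> stabilizes \<open>q\<close>, it stabilizes its multiple \<open>p\<close>, but each \<open>z > z0\<close> moves some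
  \<open>y' < y\<close> beyond \<open>y\<close> and so moves \<open>p\<close> to at least \<open>q\<close>. The point \<open>y1\<close> keeps the values below \<open>e\<close>
  on the right of \<open>z0\<close>.
\<close>

lemma section_left_limit_interior:
  assumes x: "0 \<le> x" "x \<le> e" and y: "e < y" "y < y1" "y1 \<le> 1" "U x y1 < e" and p: "p < U x y"
  shows "\<exists>y'<y. e \<le> y' \<and> p < U x y'"
proof (rule ccontr)
  assume "\<not> ?thesis"
  then have le_p: "U x y' \<le> p" if "e \<le> y'" "y' < y" for y'
    using that by force
  have "x \<le> p" using le_p[of e] neutral_right[of x] x y e_less_1 by simp
  obtain z0 where z0: "e \<le> z0" "z0 < 1" "U y z0 = y" "U z0 z0 = z0"
      "\<And>z. z0 < z \<Longrightarrow> z \<le> 1 \<Longrightarrow> y < U y z"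
    using maximal_stabilizer[of y] y by auto
  define q where "q = U x y"
  have q: "0 \<le> q" "q < e"
    using mono[of x x y y1] nonneg[of x y] x y e_pos e_less_1 by (auto simp: q_def)
  have shift: "U q z = U x (U y z)" if "e \<le> z" "z \<le> 1" for z
    unfolding q_def using that x y e_pos e_less_1 by (intro assoc) auto
  have "p < q" using p by (simp add: q_def)
  obtain w where w: "0 \<le> w" "w \<le> e" "U q w = p"
    using lower_divisible[of p q] \<open>p < q\<close> \<open>x \<le> p\<close> x q by auto
  have "U p z0 = p"
    using swap[of q w z0] shift[of z0] z0 w q e_pos e_less_1 by (simp add: q_def)
  obtain z1 where z1: "z0 < z1" "z1 \<le> 1" "U y z1 < y1"
    using continuous_on_Icc_less_right[OF upper_section, of y z0 y1] z0 y by auto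
  have "U q z1 < e"
    using shift[of z1] mono[of x x "U y z1" y1] nonneg[of y z1] x y z0 z1 e_pos e_less_1 by simp
  then have "U p z1 < e"
    using mono[of p q z1 z1] \<open>p < q\<close> \<open>x \<le> p\<close> x q z0 z1 e_less_1 by simp
  then obtain z where z: "z0 < z" "z \<le> 1" "U p z < q"
    using right_limit_at_idempotent[of z0 z1 p q] z0 z1 \<open>p < q\<close> \<open>x \<le> p\<close> x q by auto
  have "y < U z y"
    using z0(5)[of z] z comm[of y z] z0(1) y e_pos by simp
  then obtain y' where y': "y' < y" "e \<le> y'" "y < U z y'"
    using continuous_on_Icc_greater_left[OF upper_section, of z y y] z z0(1) y by auto
  have "U x y \<le> U x (U y' z)"
    using y' comm[of y' z] z z0(1) x y e_pos e_less_1 le_1[of z y'] by (intro mono) auto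
  also have "\<dots> = U (U x y') z"
    using y' z z0(1) x y e_pos e_less_1 by (intro assoc[symmetric]) auto
  also have "\<dots> \<le> U p z"
    using le_p[of y'] nonneg[of x y'] y' z z0(1) x y \<open>p < q\<close> q e_pos e_less_1 by (intro mono) auto
  finally show False using z by (simp add: q_def)
qed

text \<open>
  Nothing is known here about the values on the right of \<open>y\<close>. If \<open>y\<close> is idempotent, it stabilizes
  \<open>q = U x y\<close> and hence \<open>x\<close>, which is a multiple of \<open>q\<close>, so that \<open>U x y = x\<close> and there is no jump. Otherwise
  \<open>y = U t t\<close> with \<open>t < y\<close>. By \<open>section_onto\<close> the section \<open>U _ t\<close> takes a value \<open>s\<close> strictly inside
  the jump at some \<open>a \<le> U x t\<close>. On \<open>[e, t]\<close>, which lies strictly below \<open>y\<close>, the section \<open>U x\<close> is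
  already known to be continuous, so \<open>a = U x y'\<close> with \<open>y' \<le> t\<close>, and \<open>s = U x (U y' t)\<close> is a value of
  \<open>U x\<close> at a point of \<open>[e, y]\<close>. No such value lies inside the jump.
\<close>

lemma section_left_limit_less:
  assumes x: "0 \<le> x" "x \<le> e" and y: "e < y" "y \<le> 1" "U x y < e" and p: "p < U x y"
  shows "\<exists>y'<y. e \<le> y' \<and> p < U x y'"
proof (rule ccontr)
  assume "\<not> ?thesis"
  then have le_p: "U x y' \<le> p" if "e \<le> y'" "y' < y" for y'
    using that by force
  have "x \<le> p" using le_p[of e] neutral_right[of x] x y e_less_1 by simp
  define q where "q = U x y"
  have q: "0 \<le> q" "q < e" "p < q"
    using nonneg[of x y] x y e_pos e_less_1 p by (auto simp: q_def)
  have "U y y \<noteq> y"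
  proof
    assume idem: "U y y = y"
    have "U q y = q"
      unfolding q_def using assoc[of x y y] x y e_pos e_less_1 idem by simp
    obtain w where w: "0 \<le> w" "w \<le> e" "U q w = x"
      using lower_divisible[of x q] \<open>x \<le> p\<close> x q by auto
    have "U x y = x"
      using swap[of q w y] w \<open>U q y = q\<close> q y e_pos e_less_1 by simp
    then show False using p \<open>x \<le> p\<close> by simp
  qed
  then have "y < U y y"
    using ge_left[of y y] y e_pos by simp
  moreover have "U e e = e" using neutral_left[of e] e_pos e_less_1 by simp
  ultimately obtain t where t: "e \<le> t" "t \<le> y" "U t t = y"
    using IVT'[of "\<lambda>t. U t t" e y y] continuous_on_subset[OF upper_diagonal, of "{e..y}"] y by auto
  then have "t < y" using \<open>y < U y y\<close> by (cases "t = y") auto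
  define f where "f = U x"
  have f_t: "0 \<le> f t" "f t \<le> p" "U (f t) t = q"
    unfolding f_def q_def using le_p[of t] nonneg[of x t] assoc[of x t t] t \<open>t < y\<close> x y e_pos e_less_1
    by auto
  define s where "s = (p + q) / 2"
  have s: "p < s" "s < q" using \<open>p < q\<close> by (auto simp: s_def)
  obtain a where a: "0 \<le> a" "a \<le> f t" "U a t = s"
    using section_onto[of "f t" t s] f_t t y q s e_pos by auto
  have "x \<le> a"
  proof (rule ccontr)
    assume "\<not> x \<le> a"
    then have "U a t \<le> U x t"
      using a t x y e_pos e_less_1 by (intro mono) auto
    then show False using a s le_p[of t] t \<open>t < y\<close> by simp
  qed
  have "\<exists>y'. e \<le> y' \<and> y' \<le> t \<and> f y' = a"
  proof (rule mono_intermediate_value)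
    show "mono_on {e..t} f"
      unfolding f_def using x t y e_pos e_less_1 by (auto intro!: mono_onI mono)
    show "f e \<le> a" using \<open>x \<le> a\<close> neutral_right[of x] x e_less_1 by (simp add: f_def)
    fix y'
    show "\<exists>y''>y'. y'' \<le> t \<and> f y'' < a" if y': "e \<le> y'" "y' < t" "f y' < a"
    proof -
      obtain y'' where y'': "y' < y''" "y'' \<le> 1" "f y'' < a"
        using section_right_limit[of x y' y a] x y y' t by (auto simp: f_def)
      have "f (min y'' t) \<le> f y''"
        unfolding f_def using x y' y'' t e_pos e_less_1 by (intro mono) auto
      then show ?thesis using y' y'' by (intro exI[of _ "min y'' t"]) auto
    qed
    show "\<exists>y''<y'. e \<le> y'' \<and> a < f y''" if y': "e < y'" "y' \<le> t" "a < f y'"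
      using section_left_limit_interior[of x y' y a] x y y' \<open>t < y\<close> by (auto simp: f_def)
  qed (use t a in auto)
  then obtain y' where y': "e \<le> y'" "y' \<le> t" "f y' = a" by blast
  have "s = U x (U y' t)"
    using assoc[of x y' t] y' a t x y e_pos e_less_1 by (simp add: f_def)
  moreover have "e \<le> U y' t" "U y' t \<le> y"
    using mono[of y' t t t] ge_left[of y' t] t y y' e_pos by auto
  ultimately show False
    using le_p[of "U y' t"] s by (cases "U y' t = y") (auto simp: q_def)
qed

text \<open>
  At the value \<open>e\<close> the element \<open>x\<close> is invertible with inverse \<open>y\<close>, and \<open>U x (U y p) = p\<close> exhibits the
  values just below \<open>e\<close>.
\<close>

lemma section_left_limit:
  assumes x: "0 \<le> x" "x \<le> e" and y: "e < y" "y \<le> 1" "U x y \<le> e" and p: "p < U x y"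
  shows "\<exists>y'<y. e \<le> y' \<and> p < U x y'"
proof (cases "U x y = e")
  case True
  define p' where "p' = (max p 0 + e) / 2"
  have p': "p < p'" "0 \<le> p'" "p' < e" using p True e_pos by (auto simp: p'_def)
  define y' where "y' = U y p'"
  have y': "0 \<le> y'" "y' \<le> y" "U x y' = p'"
    unfolding y'_def
    using nonneg[of y p'] le_left[of y p'] assoc[of x y p'] neutral_left[of p'] x y p' True e_pos e_less_1
    by auto
  then have "y' \<noteq> y" using True p' by auto
  moreover have "U x y' \<le> U x (max e y')"
    using y' x y e_pos e_less_1 by (intro mono) auto
  ultimately show ?thesis
    using y' p' y by (intro exI[of _ "max e y'"]) auto
next
  case False
  then show ?thesis using section_left_limit_less assms by simp
qed

section \<open>One-sided continuity of the uninorm\<close>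

text \<open>
  First decrease \<open>y\<close> by \<open>section_left_limit\<close>, then \<open>x\<close> by \<open>section_onto\<close>; neither step loses more than
  the allowed amount.
\<close>

lemma left_continuous_at_mixed:
  assumes x: "0 \<le> x" "x \<le> e" and y: "e < y" "y \<le> 1" "U x y \<le> e"
  shows "left_continuous_at U x y"
proof (rule left_continuous_atI)
  fix p assume "p < U x y"
  then obtain y' where y': "y' < y" "e \<le> y'" "p < U x y'"
    using section_left_limit[of x y p] assms by auto
  have "U x y' \<le> e"
    using mono[of x x y' y] assms y' e_pos e_less_1 by auto
  show "\<exists>x' y'. 0 \<le> x' \<and> (x' < x \<or> x' = x \<and> x = 0) \<and>
      0 \<le> y' \<and> (y' < y \<or> y' = y \<and> y = 0) \<and> p < U x' y'"
  proof (cases "0 < U x y'")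
    case True
    define v where "v = (max p 0 + U x y') / 2"
    have v: "0 \<le> v" "v < U x y'" "p < v" using True y' by (auto simp: v_def)
    then obtain x' where "0 \<le> x'" "x' \<le> x" "U x' y' = v"
      using section_onto[of x y' v] x y y' \<open>U x y' \<le> e\<close> by auto
    moreover from this have "x' \<noteq> x" using v by auto
    ultimately show ?thesis
      using v y' e_pos by (intro exI[of _ x'] exI[of _ y']) auto
  next
    case False
    then have "x = 0" using ge_left[of x y'] x y y' e_less_1 by auto
    then show ?thesis using y' e_pos by (intro exI[of _ 0] exI[of _ y']) auto
  qed
qed (use assms e_pos e_less_1 in auto)

lemma lower_near:
  assumes "0 \<le> x" "x \<le> e" "0 \<le> y" "y \<le> e" "\<epsilon> > 0"
  obtains d where "d > 0" "\<And>a b. 0 \<le> a \<Longrightarrow> a \<le> e \<Longrightarrow> 0 \<le> b \<Longrightarrow> b \<le> e \<Longrightarrow>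
    \<bar>a - x\<bar> \<le> d \<Longrightarrow> \<bar>b - y\<bar> \<le> d \<Longrightarrow> \<bar>U a b - U x y\<bar> < \<epsilon>"
proof -
  have "(x, y) \<in> {0..e} \<times> {0..e}" using assms by simp
  then obtain d where d: "d > 0" "\<forall>z\<in>{0..e} \<times> {0..e}. dist z (x, y) < d \<longrightarrow>
      dist (case z of (x, y) \<Rightarrow> U x y) (case (x, y) of (x, y) \<Rightarrow> U x y) < \<epsilon>"
    using lower \<open>\<epsilon> > 0\<close> unfolding continuous_on_iff by meson
  have "\<bar>U a b - U x y\<bar> < \<epsilon>"
    if "0 \<le> a" "a \<le> e" "0 \<le> b" "b \<le> e" "\<bar>a - x\<bar> \<le> d / 3" "\<bar>b - y\<bar> \<le> d / 3" for a b
  proof -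
    have "dist (a, b) (x, y) \<le> \<bar>a - x\<bar> + \<bar>b - y\<bar>"
      unfolding dist_Pair_Pair dist_real_def using sqrt_sum_squares_le_sum_abs[of "a - x" "b - y"] by simp
    also have "\<dots> < d" using that d(1) by linarith
    finally show ?thesis
      using d(2)[rule_format, of "(a, b)"] that by (simp add: dist_real_def)
  qed
  then show ?thesis using that[of "d / 3"] d(1) by simp
qed

lemma left_continuous_at_lower:
  assumes "0 \<le> x" "x \<le> e" "0 \<le> y" "y \<le> e"
  shows "left_continuous_at U x y"
  unfolding left_continuous_at_def
proof (intro allI impI)
  fix \<epsilon> :: real assume "\<epsilon> > 0"
  then obtain d where d: "d > 0" "\<And>a b. 0 \<le> a \<Longrightarrow> a \<le> e \<Longrightarrow> 0 \<le> b \<Longrightarrow> b \<le> e \<Longrightarrow>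
      \<bar>a - x\<bar> \<le> d \<Longrightarrow> \<bar>b - y\<bar> \<le> d \<Longrightarrow> \<bar>U a b - U x y\<bar> < \<epsilon>"
    using lower_near assms by blast
  then show "\<exists>\<delta>>0. \<forall>a\<in>{0..1}. \<forall>b\<in>{0..1}.
      a \<in> {x - \<delta>..x} \<longrightarrow> b \<in> {y - \<delta>..y} \<longrightarrow> \<bar>U a b - U x y\<bar> < \<epsilon>"
    using assms by (intro exI[of _ d]) simp
qed

theorem left_continuous_at_below_neutral:
  assumes xy: "0 \<le> x" "x \<le> 1" "0 \<le> y" "y \<le> 1" and le: "U x y \<le> e"
  shows "left_continuous_at U x y"
proof -
  have "x \<le> e" if "e < y"
    using ge_left[of x y] xy le that by simp
  moreover have "y \<le> e" if "e < x"
    using ge_right[of y x] xy le that by simp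
  ultimately consider "x \<le> e" "y \<le> e" | "x \<le> e" "e < y" | "y \<le> e" "e < x" by linarith
  then show ?thesis
  proof cases
    case 1 then show ?thesis using left_continuous_at_lower xy by simp
  next
    case 2 then show ?thesis using left_continuous_at_mixed xy le by simp
  next
    case 3
    then have "left_continuous_at U y x"
      using left_continuous_at_mixed xy le comm[of x y] by simp
    then show ?thesis using left_continuous_at_comm xy by simp
  qed
qed

lemma right_continuous_at_mixed:
  assumes x: "0 \<le> x" "x < x1" "x1 \<le> e" and y: "e \<le> y" "y < y1" "y1 \<le> 1" and less: "U x1 y1 < e"
  shows "right_continuous_at U x y"
proof (rule right_continuous_atI)
  fix p assume p: "U x y < p"
  have "U x y1 < e"
    using mono[of x x1 y1 y1] assms e_pos e_less_1 by auto
  then obtain y2 where y2: "y < y2" "y2 \<le> 1" "U x y2 < p"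
    using section_right_limit[of x y y1 p] assms p by auto
  define y' where "y' = min y1 y2"
  have y': "y < y'" "y' \<le> 1" "U x y' < p"
    using mono[of x x y' y2] y2 assms e_pos e_less_1 by (auto simp: y'_def)
  have "U x1 y' < e"
    using mono[of x1 x1 y' y1] less assms y' e_pos e_less_1 by (auto simp: y'_def)
  show "\<exists>x' y'. x < x' \<and> x' \<le> 1 \<and> y < y' \<and> y' \<le> 1 \<and> U x' y' < p"
  proof (cases "U x1 y' < p")
    case True
    then show ?thesis using assms y' e_less_1 by (intro exI[of _ x1] exI[of _ y']) auto
  next
    case False
    define v where "v = (U x y' + p) / 2"
    have v: "U x y' < v" "v < p" using y' by (auto simp: v_def)
    moreover have "0 \<le> v" using v nonneg[of x y'] assms y' e_pos e_less_1 by auto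
    ultimately obtain x' where x': "0 \<le> x'" "x' \<le> x1" "U x' y' = v"
      using section_onto[of x1 y' v] assms y' \<open>U x1 y' < e\<close> False by auto
    have "x < x'"
    proof (rule ccontr)
      assume "\<not> x < x'"
      then have "U x' y' \<le> U x y'" using x' y' assms e_pos e_less_1 by (intro mono) auto
      then show False using x' v by simp
    qed
    then show ?thesis using x' y' v assms e_less_1 by (intro exI[of _ x'] exI[of _ y']) auto
  qed
qed (use assms e_pos e_less_1 in auto)

lemma right_continuous_at_lower:
  assumes "0 \<le> x" "x < e" "0 \<le> y" "y < e"
  shows "right_continuous_at U x y"
  unfolding right_continuous_at_def
proof (intro allI impI)
  fix \<epsilon> :: real assume "\<epsilon> > 0"
  then obtain d where d: "d > 0" "\<And>a b. 0 \<le> a \<Longrightarrow> a \<le> e \<Longrightarrow> 0 \<le> b \<Longrightarrow> b \<le> e \<Longrightarrow>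
      \<bar>a - x\<bar> \<le> d \<Longrightarrow> \<bar>b - y\<bar> \<le> d \<Longrightarrow> \<bar>U a b - U x y\<bar> < \<epsilon>"
    using lower_near[of x y] assms by (metis less_imp_le)
  define \<delta> where "\<delta> = min d (min (e - x) (e - y))"
  have \<delta>: "\<delta> > 0" "\<delta> \<le> d" "\<delta> \<le> e - x" "\<delta> \<le> e - y" using d(1) assms by (auto simp: \<delta>_def)
  then show "\<exists>\<delta>>0. \<forall>a\<in>{0..1}. \<forall>b\<in>{0..1}.
      a \<in> {x..x + \<delta>} \<longrightarrow> b \<in> {y..y + \<delta>} \<longrightarrow> \<bar>U a b - U x y\<bar> < \<epsilon>"
    using assms by (intro exI[of _ \<delta>]) (auto intro!: d(2))
qed

text \<open>
  The value at the point \<open>(x1, y1)\<close> guarantees that right-hand jumps at \<open>(x, y)\<close> stay below \<open>e\<close>, where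
  divisibility is available. Jumps across the level \<open>e\<close> do occur in general.
\<close>

theorem right_continuous_at_below_level:
  assumes x: "0 \<le> x" "x < x1" "x1 \<le> 1" and y: "0 \<le> y" "y < y1" "y1 \<le> 1" and less: "U x1 y1 < e"
  shows "right_continuous_at U x y"
proof -
  have aux: "right_continuous_at U x y"
    if xy: "0 \<le> x" "x < x1" "x1 \<le> 1" "0 \<le> y" "y < y1" "y1 \<le> 1" "U x1 y1 < e" "x1 < e" for x y x1 y1
    using right_continuous_at_mixed[of x x1 y y1] right_continuous_at_lower[of x y] xy
    by (cases "e \<le> y") auto
  show ?thesis
  proof (cases "x1 < e")
    case True
    then show ?thesis using aux[of x x1 y y1] x y less by simp
  next
    case False
    then have "y1 < e" using ge_right[of y1 x1] less x y by simp
    moreover have "U y1 x1 < e" using less comm[of x1 y1] x y by simp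
    ultimately have "right_continuous_at U y x" using aux[of y y1 x x1] x y by simp
    then show ?thesis using right_continuous_at_comm x y by simp
  qed
qed

theorem two_sided_continuous_below_level:
  assumes "0 \<le> x" "x < x1" "x1 \<le> 1" "0 \<le> y" "y < y1" "y1 \<le> 1" "U x1 y1 < e"
  shows "left_continuous_at U x y \<and> right_continuous_at U x y"
  using right_continuous_at_below_level[of x x1 y y1] left_continuous_at_below_neutral[of x y]
    mono[of x x1 y y1] assms by simp

end

lemma (in underlying_continuous_uninorm) underlying_continuous_uninorm_dual:
  "underlying_continuous_uninorm (dual_uninorm U) (1 - e)"
proof -
  interpret dual: neutral_uninorm "dual_uninorm U" "1 - e"
    by (rule neutral_uninorm_dual)
  show ?thesis
    using continuous_on_dual_uninorm[OF lower] continuous_on_dual_uninorm[OF upper]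
    by unfold_locales simp_all
qed

context underlying_continuous_uninorm
begin

interpretation dual: underlying_continuous_uninorm "dual_uninorm U" "1 - e"
  by (rule underlying_continuous_uninorm_dual)

theorem right_continuous_at_above_neutral:
  assumes "0 \<le> x" "x \<le> 1" "0 \<le> y" "y \<le> 1" "e \<le> U x y"
  shows "right_continuous_at U x y"
  using dual.left_continuous_at_below_neutral[of "1 - x" "1 - y"] assms
  by (simp add: left_continuous_at_dual_uninorm) (simp add: dual_uninorm_def)

theorem two_sided_continuous_above_level:
  assumes "0 \<le> x1" "x1 < x" "x \<le> 1" "0 \<le> y1" "y1 < y" "y \<le> 1" "e < U x1 y1"
  shows "left_continuous_at U x y \<and> right_continuous_at U x y"
  using dual.two_sided_continuous_below_level[of "1 - x" "1 - x1" "1 - y" "1 - y1"] assms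
  by (simp add: left_continuous_at_dual_uninorm right_continuous_at_dual_uninorm)
    (simp add: dual_uninorm_def)

end

section \<open>The level curve of the neutral element\<close>

context neutral_uninorm
begin

text \<open>
  The set of points with \<open>U \<le> e\<close> strictly below and \<open>U \<ge> e\<close> strictly above. Comparing with strictly
  smaller and larger points fills the gaps at which \<open>U\<close> jumps across \<open>e\<close>, and makes the
  conditions vacuous on the border of the square, so that the curve continues along the border up to
  its corners and is surjective even if \<open>U\<close> does not take the value \<open>e\<close> there.
\<close>

definition level_curve :: "real \<Rightarrow> real set"
  where "level_curve x = {y \<in> {0..1}. (\<forall>x'\<in>{0..<x}. \<forall>y'\<in>{0..<y}. U x' y' \<le> e) \<and>
    (\<forall>x'\<in>{x<..1}. \<forall>y'\<in>{y<..1}. e \<le> U x' y')}"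

lemma level_curve_set_valued: "set_valued_function level_curve"
  by (auto simp: set_valued_function_def level_curve_def)

lemma level_curve_symmetric: "sv_symmetric level_curve"
proof -
  have "x \<in> level_curve y" if "y \<in> level_curve x" "x \<in> {0..1}" "y \<in> {0..1}" for x y
    unfolding level_curve_def
  proof (intro CollectI conjI ballI)
    show "U y' x' \<le> e" if "y' \<in> {0..<y}" "x' \<in> {0..<x}" for x' y'
    proof -
      have "U x' y' \<le> e" using that \<open>y \<in> level_curve x\<close> by (auto simp: level_curve_def)
      then show ?thesis using that \<open>x \<in> {0..1}\<close> \<open>y \<in> {0..1}\<close> comm[of x' y'] by simp
    qed
    show "e \<le> U y' x'" if "y' \<in> {y<..1}" "x' \<in> {x<..1}" for x' y'
    proof -
      have "e \<le> U x' y'" using that \<open>y \<in> level_curve x\<close> by (auto simp: level_curve_def)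
      then show ?thesis using that \<open>x \<in> {0..1}\<close> \<open>y \<in> {0..1}\<close> comm[of x' y'] by simp
    qed
  qed (use that in auto)
  then show ?thesis unfolding sv_symmetric_def by blast
qed

text \<open>
  Over the height \<open>y\<close> the curve passes through the last point up to which \<open>U _ y\<close> is below \<open>e\<close>. The
  point \<open>0\<close> is included because \<open>U _ y\<close> can be above \<open>e\<close> from the start.
\<close>

lemma level_curve_surjective: "sv_surjective level_curve"
  unfolding sv_surjective_def
proof
  fix y :: real assume y: "y \<in> {0..1}"
  define A where "A = insert 0 {x \<in> {0..1}. U x y < e}"
  have A: "0 \<in> A" "bdd_above A" by (auto simp: A_def intro!: bdd_aboveI[of _ 1])
  define x where "x = Sup A"
  have x: "0 \<le> x" "x \<le> 1"
    unfolding x_def using cSup_upper[OF A] A(1) by (auto simp: A_def intro!: cSup_least)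
  have "U x' y' \<le> e" if x': "x' \<in> {0..<x}" and y': "y' \<in> {0..<y}" for x' y'
  proof -
    have "A \<noteq> {}" using A by blast
    then obtain a where "a \<in> A" "x' < a"
      using less_cSupD[of A x'] x' unfolding x_def by auto
    then have "a \<le> 1" "U a y < e" using x' by (auto simp: A_def)
    moreover have "U x' y' \<le> U a y"
      using x' y' y \<open>x' < a\<close> \<open>a \<le> 1\<close> by (intro mono) auto
    ultimately show ?thesis by simp
  qed
  moreover have "e \<le> U x' y'" if x': "x' \<in> {x<..1}" and y': "y' \<in> {y<..1}" for x' y'
  proof -
    have "x' \<notin> A" using cSup_upper[OF _ A(2), of x'] x' unfolding x_def by auto
    then have "e \<le> U x' y" using x x' by (auto simp: A_def)
    also have "\<dots> \<le> U x' y'" using x x' y y' by (intro mono) auto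
    finally show ?thesis .
  qed
  ultimately have "y \<in> level_curve x" using y by (auto simp: level_curve_def)
  then show "\<exists>x\<in>{0..1}. y \<in> level_curve x" using x by auto
qed

text \<open>
  Two points of the curve in increasing position would enclose an open rectangle on which \<open>U = e\<close>.
\<close>

lemma level_curve_nonincreasing: "sv_nonincreasing level_curve"
  unfolding sv_nonincreasing_def
proof (intro ballI impI, rule ccontr)
  fix x1 x2 y1 y2 assume x: "x1 \<in> {0..1::real}" "x2 \<in> {0..1}" "x1 < x2"
    and y: "y1 \<in> level_curve x1" "y2 \<in> level_curve x2" "\<not> y2 \<le> y1"
  have level: "U p q = e" if "x1 < p" "p < x2" "y1 < q" "q < y2" for p q
  proof (rule antisym)
    show "U p q \<le> e" using that x y by (auto simp: level_curve_def)
    show "e \<le> U p q" using that x y by (auto simp: level_curve_def)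
  qed
  obtain p where "x1 < p" "p < x2" using dense[OF x(3)] by blast
  moreover obtain p' where "p < p'" "p' < x2" using dense[OF \<open>p < x2\<close>] by blast
  moreover obtain q where "y1 < q" "q < y2" using dense[of y1 y2] y(3) by auto
  ultimately have "x1 < p" "p < p'" "p' < x2" "y1 < q" "q < y2" by blast+
  then show False
    using inverse_unique[of p p' q] level[of p q] level[of p' q] x y by (auto simp: level_curve_def)
qed

lemma level_subset_level_curve:
  assumes "0 \<le> x" "x \<le> 1" "0 \<le> y" "y \<le> 1" "U x y = e"
  shows "y \<in> level_curve x"
proof -
  have "U x' y' \<le> U x y" if "x' \<in> {0..<x}" "y' \<in> {0..<y}" for x' y'
    using that assms by (intro mono) auto
  moreover have "U x y \<le> U x' y'" if "x' \<in> {x<..1}" "y' \<in> {y<..1}" for x' y'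
    using that assms by (intro mono) auto
  ultimately show ?thesis using assms by (auto simp: level_curve_def)
qed

end

lemma (in underlying_continuous_uninorm) continuous_off_level_curve:
  assumes "0 \<le> x" "x \<le> 1" "0 \<le> y" "y \<le> 1" "y \<notin> level_curve x"
  shows "continuous (at (x, y) within unit_square) (\<lambda>(x, y). U x y)"
proof -
  from assms consider x' y' where "x' \<in> {0..<x}" "y' \<in> {0..<y}" "e < U x' y'"
    | x' y' where "x' \<in> {x<..1}" "y' \<in> {y<..1}" "U x' y' < e"
    by (force simp: level_curve_def)
  then have "left_continuous_at U x y \<and> right_continuous_at U x y"
    using two_sided_continuous_above_level two_sided_continuous_below_level assms by cases auto
  then show ?thesis using continuous_iff_left_right assms by blast
qed

lemma (in underlying_continuous_uninorm) mem_class_UR: "U \<in> class_UR"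
  unfolding class_UR_def
proof (intro CollectI exI conjI)
  show "uninorm_with U e" by (rule uninorm)
  show "\<forall>z\<in>unit_square - sv_graph level_curve. continuous (at z within unit_square) (\<lambda>(x, y). U x y)"
    by (auto simp: sv_graph_def intro!: continuous_off_level_curve)
  show "\<forall>x\<in>{0..1}. \<forall>y\<in>{0..1}. U x y = e \<longrightarrow> (x, y) \<in> sv_graph level_curve"
    using level_subset_level_curve by (auto simp: sv_graph_def)
qed (fact level_curve_set_valued level_curve_symmetric level_curve_surjective level_curve_nonincreasing)+

section \<open>From one-sided continuity to continuous underlying operations\<close>

lemma (in neutral_uninorm) continuous_on_section:
  assumes "0 \<le> x" "x \<le> 1" "0 \<le> a" "b \<le> 1"
    and left: "\<And>y. a < y \<Longrightarrow> y \<le> b \<Longrightarrow> left_continuous_at U x y"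
    and right: "\<And>y. a \<le> y \<Longrightarrow> y \<le> b \<Longrightarrow> right_continuous_at U x y"
  shows "continuous_on {a..b} (U x)"
  unfolding continuous_on_iff
proof (intro ballI allI impI)
  fix y \<epsilon> :: real assume y: "y \<in> {a..b}" and \<epsilon>: "\<epsilon> > 0"
  obtain d1 where d1: "d1 > 0" "\<And>b. b \<in> {0..1} \<Longrightarrow> b \<in> {y..y + d1} \<Longrightarrow> \<bar>U x b - U x y\<bar> < \<epsilon>"
  proof -
    obtain d where "d > 0" "\<forall>a\<in>{0..1}. \<forall>b\<in>{0..1}. a \<in> {x..x + d} \<longrightarrow> b \<in> {y..y + d} \<longrightarrow> \<bar>U a b - U x y\<bar> < \<epsilon>"
      using right[of y] y \<epsilon> unfolding right_continuous_at_def by auto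
    then show ?thesis using assms(1,2) that[of d] by auto
  qed
  obtain d2 where d2: "d2 > 0" "\<And>b. b \<in> {a..1} \<Longrightarrow> b \<in> {y - d2..y} \<Longrightarrow> \<bar>U x b - U x y\<bar> < \<epsilon>"
  proof (cases "y = a")
    case True
    then show ?thesis using that[of 1] \<epsilon> by auto
  next
    case False
    then obtain d where "d > 0" "\<forall>a\<in>{0..1}. \<forall>b\<in>{0..1}. a \<in> {x - d..x} \<longrightarrow> b \<in> {y - d..y} \<longrightarrow> \<bar>U a b - U x y\<bar> < \<epsilon>"
      using left[of y] y \<epsilon> unfolding left_continuous_at_def by auto
    then show ?thesis using assms(1-3) that[of d] by auto
  qed
  have "dist (U x b') (U x y) < \<epsilon>" if "b' \<in> {a..b}" "dist b' y < min d1 d2" for b'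
    using d1(2)[of b'] d2(2)[of b'] that y assms by (cases "b' \<le> y") (auto simp: dist_real_def)
  then show "\<exists>d>0. \<forall>b'\<in>{a..b}. dist b' y < d \<longrightarrow> dist (U x b') (U x y) < \<epsilon>"
    using d1(1) d2(1) by (intro exI[of _ "min d1 d2"]) auto
qed

text \<open>
  Continuity off the curve is split into its left and right parts so that the assumptions are visibly
  invariant under duality.
\<close>

locale curve_continuous_uninorm = neutral_uninorm +
  fixes r :: "real \<Rightarrow> real set"
  assumes symmetric: "x \<in> {0..1} \<Longrightarrow> y \<in> {0..1} \<Longrightarrow> y \<in> r x \<Longrightarrow> x \<in> r y"
    and nonincreasing: "x1 \<in> {0..1} \<Longrightarrow> x2 \<in> {0..1} \<Longrightarrow> x1 < x2 \<Longrightarrow> y1 \<in> {0..1} \<Longrightarrow> y2 \<in> {0..1} \<Longrightarrow>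
      y1 \<in> r x1 \<Longrightarrow> y2 \<in> r x2 \<Longrightarrow> y2 \<le> y1"
    and off_curve: "x \<in> {0..1} \<Longrightarrow> y \<in> {0..1} \<Longrightarrow> y \<notin> r x \<Longrightarrow>
      left_continuous_at U x y \<and> right_continuous_at U x y"
    and level_on_curve: "x \<in> {0..1} \<Longrightarrow> y \<in> {0..1} \<Longrightarrow> U x y = e \<Longrightarrow> y \<in> r x"
    and one_sided: "x \<in> {0..1} \<Longrightarrow> y \<in> {0..1} \<Longrightarrow> left_continuous_at U x y \<or> right_continuous_at U x y"
begin

text \<open>
  If left-continuity fails at \<open>(x, e)\<close> by \<open>\<epsilon>\<close>, then \<open>U s y \<le> x - \<epsilon>\<close> for all \<open>s < x\<close> and \<open>y < e\<close>, whereas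
  \<open>U s e = s\<close>. Hence left-continuity fails at every \<open>(s, e)\<close> with \<open>x - \<epsilon> < s < x\<close>; these points lie on
  the curve, and \<open>U\<close> is right-continuous there. By monotonicity of the curve, \<open>U\<close> is continuous and
  different from \<open>e\<close> at all points above \<open>e\<close> and to the right of one of them. Following \<open>U\<close> from
  \<open>(s, e)\<close> up to \<open>(s, 1)\<close> and then right to \<open>(e, 1)\<close> leads from \<open>s < e\<close> to \<open>1 > e\<close> without meeting \<open>e\<close>.
\<close>

lemma left_continuous_at_neutral:
  assumes x: "0 \<le> x" "x \<le> e"
  shows "left_continuous_at U x e"
proof (rule ccontr)
  assume "\<not> left_continuous_at U x e"
  then obtain \<epsilon> where \<epsilon>: "\<epsilon> > 0" and no_\<delta>: "\<not> (\<exists>\<delta>>0. \<forall>a\<in>{0..1}. \<forall>b\<in>{0..1}.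
      a \<in> {x - \<delta>..x} \<longrightarrow> b \<in> {e - \<delta>..e} \<longrightarrow> \<bar>U a b - U x e\<bar> < \<epsilon>)"
    unfolding left_continuous_at_def by blast
  have gap: "\<exists>a\<in>{0..1}. \<exists>b\<in>{0..1}. a \<in> {x - \<delta>..x} \<and> b \<in> {e - \<delta>..e} \<and> \<epsilon> \<le> \<bar>U a b - U x e\<bar>"
    if "\<delta> > 0" for \<delta>
  proof (rule ccontr)
    assume "\<not> ?thesis"
    then have "\<forall>a\<in>{0..1}. \<forall>b\<in>{0..1}. a \<in> {x - \<delta>..x} \<longrightarrow> b \<in> {e - \<delta>..e} \<longrightarrow> \<bar>U a b - U x e\<bar> < \<epsilon>"
      using not_le by blast
    then show False using no_\<delta> that by blast
  qed
  have gap': "U s y \<le> x - \<epsilon>" if "0 \<le> s" "s < x" "0 \<le> y" "y < e" for s y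
  proof -
    define \<delta> where "\<delta> = min (x - s) (e - y)"
    have \<delta>: "\<delta> > 0" "s \<le> x - \<delta>" "y \<le> e - \<delta>" using that by (auto simp: \<delta>_def)
    from gap[OF \<delta>(1)] obtain a b where "a \<in> {0..1}" "b \<in> {0..1}" "a \<in> {x - \<delta>..x}" "b \<in> {e - \<delta>..e}"
      "\<epsilon> \<le> \<bar>U a b - U x e\<bar>" by blast
    then have ab: "a \<in> {0..1}" "b \<in> {0..1}" "s \<le> a" "a \<le> x" "y \<le> b" "b \<le> e" "\<epsilon> \<le> \<bar>U a b - U x e\<bar>"
      using \<delta> by auto
    have "U s y \<le> U a b" "U a b \<le> U x e"
      using ab that x e_pos e_less_1 by (auto intro!: mono)
    then show ?thesis using ab neutral_right[of x] x e_less_1 by simp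
  qed
  have "0 < x" using \<epsilon> x gap[of 1] e_pos e_less_1 neutral_right[of 0] zero_left by (cases "x = 0") auto
  have "0 \<le> x - \<epsilon>" using gap'[of 0 0] zero_left[of 0] \<open>0 < x\<close> e_pos by simp
  have not_left: "\<not> left_continuous_at U s e" if s: "x - \<epsilon> < s" "s < x" for s
  proof
    assume "left_continuous_at U s e"
    moreover have "s - (x - \<epsilon>) > 0" using s by simp
    ultimately obtain \<delta> where \<delta>: "\<delta> > 0" "\<forall>a\<in>{0..1}. \<forall>b\<in>{0..1}.
        a \<in> {s - \<delta>..s} \<longrightarrow> b \<in> {e - \<delta>..e} \<longrightarrow> \<bar>U a b - U s e\<bar> < s - (x - \<epsilon>)"
      unfolding left_continuous_at_def by meson
    define y where "y = max 0 (e - \<delta>)"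
    have "0 \<le> y" "y < e" "e - \<delta> \<le> y" using \<delta>(1) e_pos by (auto simp: y_def)
    then have "\<bar>U s y - U s e\<bar> < s - (x - \<epsilon>)"
      using \<delta> s x \<open>0 \<le> x - \<epsilon>\<close> e_less_1 by auto
    moreover have "U s e = s" "U s y \<le> x - \<epsilon>"
      using neutral_right[of s] gap'[of s y] s x \<open>0 \<le> x - \<epsilon>\<close> \<open>0 \<le> y\<close> \<open>y < e\<close> e_less_1 by auto
    ultimately show False by simp
  qed
  \<comment> \<open>The point \<open>s1\<close> keeps the curve below height \<open>e\<close>; \<open>s > s1\<close> is where the path starts.\<close>
  define s1 s where "s1 = x - \<epsilon> / 2" and "s = x - \<epsilon> / 4"
  have s: "x - \<epsilon> < s1" "s1 < s" "s < x" "0 \<le> s1" "s < e"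
    using \<epsilon> \<open>0 \<le> x - \<epsilon>\<close> x by (auto simp: s1_def s_def)
  have "e \<in> r s1"
    using off_curve[of s1 e] not_left[of s1] s x e_pos e_less_1 by auto
  then have curve_le: "y \<le> e" if "s1 < t" "t \<le> 1" "0 \<le> y" "y \<le> 1" "y \<in> r t" for t y
    using nonincreasing[of s1 t e y] that s e_pos e_less_1 by auto
  have "U s e = s" using neutral_right s x e_less_1 by simp
  have "right_continuous_at U s e"
    using one_sided[of s e] not_left[of s] s x e_pos e_less_1 by auto
  have "continuous_on {e..1} (U s)"
  proof (rule continuous_on_section)
    have off: "left_continuous_at U s y \<and> right_continuous_at U s y" if "e < y" "y \<le> 1" for y
      using off_curve[of s y] curve_le[of s y] that s x e_pos e_less_1 by force
    show "left_continuous_at U s y" if "e < y" "y \<le> 1" for y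
      using off that by simp
    show "right_continuous_at U s y" if "e \<le> y" "y \<le> 1" for y
      using off[of y] that \<open>right_continuous_at U s e\<close> by (cases "y = e") auto
  qed (use s x e_pos e_less_1 in auto)
  have "U s 1 < e"
  proof (rule ccontr)
    assume "\<not> U s 1 < e"
    then obtain y where y: "e \<le> y" "y \<le> 1" "U s y = e"
      using IVT'[of "U s" e e 1] \<open>continuous_on {e..1} (U s)\<close> \<open>U s e = s\<close> s e_less_1 by auto
    then have "y \<le> e"
      using curve_le[of s y] level_on_curve[of s y] s x e_pos e_less_1 by auto
    then show False using y \<open>U s e = s\<close> s by auto
  qed
  have "continuous_on {s..e} (U 1)"
  proof (rule continuous_on_section)
    have off: "left_continuous_at U 1 t \<and> right_continuous_at U 1 t" if "s \<le> t" "t \<le> e" for t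
      using off_curve[of 1 t] curve_le[of t 1] symmetric[of 1 t] that s x e_pos e_less_1 by force
    show "left_continuous_at U 1 t" if "s < t" "t \<le> e" for t using off that by simp
    show "right_continuous_at U 1 t" if "s \<le> t" "t \<le> e" for t using off that by simp
  qed (use s x e_pos e_less_1 in auto)
  moreover have "U 1 s \<le> e" "e \<le> U 1 e"
    using \<open>U s 1 < e\<close> comm[of 1 s] neutral_right[of 1] s x e_less_1 by auto
  ultimately obtain t where t: "s \<le> t" "t \<le> e" "U 1 t = e"
    using IVT'[of "U 1" s e e] s by auto
  then have "1 \<le> e"
    using curve_le[of t 1] level_on_curve[of t 1] comm[of 1 t] s x e_pos e_less_1 by auto
  then show False using e_less_1 by simp
qed

text \<open>
  Inside \<open>[0, e)\<^sup>2\<close> there are no points of the curve, since \<open>(e, e)\<close> lies on it. On the two upper edges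
  \<open>U\<close> equals the minimum, which bounds \<open>U\<close> from above on the whole square, so that left-continuity
  suffices.
\<close>

lemma lower_continuous: "continuous_on ({0..e} \<times> {0..e}) (\<lambda>(x, y). U x y)"
  unfolding continuous_on_eq_continuous_within
proof
  fix z :: "real \<times> real" assume z: "z \<in> {0..e} \<times> {0..e}"
  have curve_ge: "e \<le> y" if "0 \<le> x" "x < e" "0 \<le> y" "y \<le> 1" "y \<in> r x" for x y
    using nonincreasing[of x e y e] level_on_curve[of e e] that neutral_left[of e] e_pos e_less_1 by auto
  obtain x y where xy: "z = (x, y)" "0 \<le> x" "x \<le> e" "0 \<le> y" "y \<le> e" using z by auto
  show "continuous (at z within {0..e} \<times> {0..e}) (\<lambda>(x, y). U x y)"
  proof (cases "x < e \<and> y < e")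
    case True
    then have "y \<notin> r x" using curve_ge[of x y] xy e_less_1 by auto
    then have "continuous (at z within unit_square) (\<lambda>(x, y). U x y)"
      using off_curve[of x y] continuous_iff_left_right[of x y] xy e_less_1 by auto
    then show ?thesis
      by (rule continuous_within_subset) (use e_less_1 in auto)
  next
    case False
    have left: "left_continuous_at U x y" "U x y = min x y"
      using False xy left_continuous_at_neutral[of x] left_continuous_at_neutral[of y] left_continuous_at_comm[of y e]
        neutral_left[of y] neutral_right[of x] e_pos e_less_1 by (cases "y = e"; auto)+
    show ?thesis
      unfolding continuous_within_eps_delta xy(1)
    proof (intro allI impI)
      fix \<epsilon> :: real assume "\<epsilon> > 0"
      then obtain \<delta> where \<delta>: "\<delta> > 0" "\<forall>a\<in>{0..1}. \<forall>b\<in>{0..1}.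
          a \<in> {x - \<delta>..x} \<longrightarrow> b \<in> {y - \<delta>..y} \<longrightarrow> \<bar>U a b - U x y\<bar> < \<epsilon>"
        using left unfolding left_continuous_at_def by meson
      have "\<bar>U a b - U x y\<bar> < \<epsilon>"
        if ab: "a \<in> {0..e}" "b \<in> {0..e}" and d: "dist (a, b) (x, y) < min \<delta> \<epsilon>" for a b
      proof -
        have near: "\<bar>a - x\<bar> < min \<delta> \<epsilon>" "\<bar>b - y\<bar> < min \<delta> \<epsilon>"
          using d dist_fst_le[of "(a, b)" "(x, y)"] dist_snd_le[of "(a, b)" "(x, y)"]
          by (auto simp: dist_real_def)
        then have "\<bar>U (min a x) (min b y) - U x y\<bar> < \<epsilon>"
          using ab xy \<delta>(1) e_less_1 by (intro \<delta>(2)[rule_format]) auto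
        moreover have "U (min a x) (min b y) \<le> U a b"
          using ab xy e_less_1 by (intro mono) auto
        moreover have "U a b \<le> a" "U a b \<le> b"
          using le_left[of a b] le_left[of b a] comm[of a b] ab e_less_1 by auto
        moreover have "U a b < U x y + \<epsilon>"
          using left(2) near \<open>U a b \<le> a\<close> \<open>U a b \<le> b\<close> by (auto simp: min_def split: if_splits)
        ultimately show ?thesis by linarith
      qed
      then show "\<exists>d>0. \<forall>z\<in>{0..e} \<times> {0..e}. dist z (x, y) < d \<longrightarrow>
          dist (case z of (x, y) \<Rightarrow> U x y) (case (x, y) of (x, y) \<Rightarrow> U x y) < \<epsilon>"
        using \<delta>(1) \<open>\<epsilon> > 0\<close> by (intro exI[of _ "min \<delta> \<epsilon>"]) (auto simp: dist_real_def)
    qed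
  qed
qed

lemma curve_continuous_uninorm_dual:
  "curve_continuous_uninorm (dual_uninorm U) (1 - e) (\<lambda>x. {y. 1 - y \<in> r (1 - x)})"
proof -
  interpret dual: neutral_uninorm "dual_uninorm U" "1 - e"
    by (rule neutral_uninorm_dual)
  show ?thesis
  proof
    show "y2 \<le> y1" if "x1 \<in> {0..1}" "x2 \<in> {0..1}" "x1 < x2" "y1 \<in> {0..1}" "y2 \<in> {0..1}"
      "y1 \<in> {y. 1 - y \<in> r (1 - x1)}" "y2 \<in> {y. 1 - y \<in> r (1 - x2)}" for x1 x2 y1 y2
      using nonincreasing[of "1 - x2" "1 - x1" "1 - y2" "1 - y1"] that by auto
    show "x \<in> {x. 1 - x \<in> r (1 - y)}" if "x \<in> {0..1}" "y \<in> {0..1}" "y \<in> {y. 1 - y \<in> r (1 - x)}" for x y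
      using symmetric[of "1 - x" "1 - y"] that by auto
    show "y \<in> {y. 1 - y \<in> r (1 - x)}" if "x \<in> {0..1}" "y \<in> {0..1}" "dual_uninorm U x y = 1 - e" for x y
      using level_on_curve[of "1 - x" "1 - y"] that by (auto simp: dual_uninorm_def)
    show "left_continuous_at (dual_uninorm U) x y \<and> right_continuous_at (dual_uninorm U) x y"
      if "x \<in> {0..1}" "y \<in> {0..1}" "y \<notin> {y. 1 - y \<in> r (1 - x)}" for x y
      using off_curve[of "1 - x" "1 - y"] that
      by (auto simp: left_continuous_at_dual_uninorm right_continuous_at_dual_uninorm)
    show "left_continuous_at (dual_uninorm U) x y \<or> right_continuous_at (dual_uninorm U) x y"
      if "x \<in> {0..1}" "y \<in> {0..1}" for x y
      using one_sided[of "1 - x" "1 - y"] that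
      by (auto simp: left_continuous_at_dual_uninorm right_continuous_at_dual_uninorm)
  qed
qed

theorem underlying_continuous: "underlying_continuous_uninorm U e"
proof -
  interpret dual: curve_continuous_uninorm "dual_uninorm U" "1 - e" "\<lambda>x. {y. 1 - y \<in> r (1 - x)}"
    by (rule curve_continuous_uninorm_dual)
  show ?thesis
    using lower_continuous continuous_on_dual_uninorm[OF dual.lower_continuous]
    by unfold_locales (simp_all add: dual_dual_uninorm)
qed

end

section \<open>The characterization\<close>

lemma continuous_on_affine_iff:
  fixes f :: "'a::topological_space \<Rightarrow> real"
  assumes "c \<noteq> 0"
  shows "continuous_on S (\<lambda>z. c * f z + d) \<longleftrightarrow> continuous_on S f"
proof
  assume "continuous_on S (\<lambda>z. c * f z + d)"
  from continuous_on_divide[OF continuous_on_diff[OF this continuous_on_const[of _ d]] continuous_on_const[of _ c]]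
  have "continuous_on S (\<lambda>z. (c * f z + d - d) / c)" using assms by simp
  then show "continuous_on S f" using assms by simp
qed (intro continuous_intros)

lemma continuous_on_rescaled_square:
  fixes U :: "real \<Rightarrow> real \<Rightarrow> real"
  assumes "0 < k"
  shows "continuous_on unit_square (\<lambda>(x, y). U (a + k * x) (a + k * y)) \<longleftrightarrow>
    continuous_on ({a..a + k} \<times> {a..a + k}) (\<lambda>(x, y). U x y)" (is "?L \<longleftrightarrow> ?R")
proof
  assume ?L
  have "continuous_on ({a..a + k} \<times> {a..a + k})
      (\<lambda>z. (\<lambda>(x, y). U (a + k * x) (a + k * y)) ((fst z - a) / k, (snd z - a) / k))"
    using assms by (intro continuous_on_compose2[OF \<open>?L\<close>] continuous_intros) auto
  then show ?R using assms by (simp add: case_prod_beta)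
next
  assume ?R
  have "continuous_on unit_square (\<lambda>z. (\<lambda>(x, y). U x y) (a + k * fst z, a + k * snd z))"
    using assms by (intro continuous_on_compose2[OF \<open>?R\<close>] continuous_intros) (auto intro: mult_left_le)
  then show ?L by (simp add: case_prod_beta)
qed

lemma (in neutral_uninorm) mem_class_U_iff: "U \<in> class_U \<longleftrightarrow> underlying_continuous_uninorm U e"
proof -
  have "continuous_on unit_square (\<lambda>(x, y). underlying_tnorm U e x y) \<longleftrightarrow>
      continuous_on unit_square (\<lambda>z. 1 / e * (\<lambda>(x, y). U (0 + e * x) (0 + e * y)) z + 0)"
    by (simp add: underlying_tnorm_def case_prod_beta)
  also have "\<dots> \<longleftrightarrow> continuous_on ({0..e} \<times> {0..e}) (\<lambda>(x, y). U x y)"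
    using e_pos by (subst continuous_on_affine_iff) (auto simp: continuous_on_rescaled_square[of e U 0, simplified])
  finally have tnorm: "continuous_on unit_square (\<lambda>(x, y). underlying_tnorm U e x y) \<longleftrightarrow> \<dots>" .
  have "continuous_on unit_square (\<lambda>(x, y). underlying_tconorm U e x y) \<longleftrightarrow>
      continuous_on unit_square
        (\<lambda>z. 1 / (1 - e) * (\<lambda>(x, y). U (e + (1 - e) * x) (e + (1 - e) * y)) z + - (e / (1 - e)))"
    by (simp add: underlying_tconorm_def case_prod_beta diff_divide_distrib)
  also have "\<dots> \<longleftrightarrow> continuous_on ({e..1} \<times> {e..1}) (\<lambda>(x, y). U x y)"
    using e_less_1 by (subst continuous_on_affine_iff) (auto simp: continuous_on_rescaled_square[of "1 - e" U e, simplified])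
  finally have tconorm: "continuous_on unit_square (\<lambda>(x, y). underlying_tconorm U e x y) \<longleftrightarrow> \<dots>" .
  have "U \<in> class_U \<longleftrightarrow> continuous_on unit_square (\<lambda>(x, y). underlying_tnorm U e x y) \<and>
      continuous_on unit_square (\<lambda>(x, y). underlying_tconorm U e x y)"
    using uninorm uninorm_neutral_unique unfolding class_U_def by blast
  then show ?thesis
    unfolding tnorm tconorm underlying_continuous_uninorm_def underlying_continuous_uninorm_axioms_def
    using neutral_uninorm_axioms by simp
qed

theorem corollary3:
  fixes U :: "real \<Rightarrow> real \<Rightarrow> real"
  assumes "uninorm U"
  shows "U \<in> class_U \<longleftrightarrow>
    (U \<in> class_UR \<and>
     (\<forall>x\<in>{0..1}. \<forall>y\<in>{0..1}. left_continuous_at U x y \<or> right_continuous_at U x y))"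
proof -
  obtain e where "uninorm_with U e" using assms by (auto simp: uninorm_def)
  then interpret neutral_uninorm U e by unfold_locales
  show ?thesis
  proof (intro iffI conjI)
    assume "U \<in> class_U"
    then interpret underlying_continuous_uninorm U e by (simp add: mem_class_U_iff)
    show "U \<in> class_UR" by (rule mem_class_UR)
    show "\<forall>x\<in>{0..1}. \<forall>y\<in>{0..1}. left_continuous_at U x y \<or> right_continuous_at U x y"
      using left_continuous_at_below_neutral right_continuous_at_above_neutral by (meson atLeastAtMost_iff linear)
  next
    assume R: "U \<in> class_UR \<and>
      (\<forall>x\<in>{0..1}. \<forall>y\<in>{0..1}. left_continuous_at U x y \<or> right_continuous_at U x y)"
    then obtain e' r where "uninorm_with U e'"
      and r: "sv_symmetric r" "sv_nonincreasing r"
      and off: "\<forall>z \<in> unit_square - sv_graph r. continuous (at z within unit_square) (\<lambda>(x, y). U x y)"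
      and level: "\<forall>x\<in>{0..1}. \<forall>y\<in>{0..1}. U x y = e' \<longrightarrow> (x, y) \<in> sv_graph r"
      unfolding class_UR_def by blast
    then have "e' = e" using uninorm uninorm_neutral_unique by blast
    interpret curve_continuous_uninorm U e r
    proof
      show "left_continuous_at U x y \<and> right_continuous_at U x y"
        if "x \<in> {0..1}" "y \<in> {0..1}" "y \<notin> r x" for x y
        using off that continuous_iff_left_right[of x y] by (auto simp: sv_graph_def)
      show "y \<in> r x" if "x \<in> {0..1}" "y \<in> {0..1}" "U x y = e" for x y
        using level that \<open>e' = e\<close> by (auto simp: sv_graph_def)
      show "x \<in> r y" if "x \<in> {0..1}" "y \<in> {0..1}" "y \<in> r x" for x y
        using r(1) that unfolding sv_symmetric_def by blast
      show "y2 \<le> y1" if "x1 \<in> {0..1}" "x2 \<in> {0..1}" "x1 < x2" "y1 \<in> r x1" "y2 \<in> r x2" for x1 x2 y1 y2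
        using r(2) that unfolding sv_nonincreasing_def by blast
      show "left_continuous_at U x y \<or> right_continuous_at U x y" if "x \<in> {0..1}" "y \<in> {0..1}" for x y
        using R that by blast
    qed
    show "U \<in> class_U" using underlying_continuous by (simp add: mem_class_U_iff)
  qed
qed

end
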